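(* Let $R(x,r,m)$ be a reward function that is independent of rank $r$, written $R(x,m)$. Then the optimal centralized welfare is $$V_c=\sup_{m}\ \sup_{\mu:\ \int_{\mathbb{R}}y\,d\mu(y)=m}\int_{\mathbb{R}}\left\{R(x,m)-2c\sigma^2\ln\left(\frac{d\mu}{d\mathcal{N}(x_0,\sigma^2T)}\right)(x)\right\}d\mu(x),$$ where $m$ ranges over $\mathbb{R}$ and $\mu$ over probability measures on $\mathbb{R}$ equivalent to $\mathcal{N}(x_0,\sigma^2T)$. The inner maximization over $\mu$ has as solution the measure $\mu(m)$ with density $$f_{\mu(m)}(x)=\frac{f_0(x)\exp\left(\frac{R(x,m)-\lambda_mx}{2c\sigma^2}\right)}{\int_{\mathbb{R}}f_0(y)\exp\left(\frac{R(y,m)-\lambda_my}{2c\sigma^2}\right)dy},$$ where $\lambda_m$ is determined by $$m=\frac{\int_{\mathbb{R}}x f_0(x)\exp\left(\frac{R(x,m)-\lambda_mx}{2c\sigma^2}\right)dx}{\int_{\mathbb{R}}f_0(y)\exp\left(\frac{R(y,m)-\lambda_my}{2c\sigma^2}\right)dy},$$ and consequently $$V_c=\sup_{m}\left\{\lambda_mm+2c\sigma^2\ln\left(\int_{\mathbb{R}}f_0(y)\exp\left(\frac{R(y,m)-\lambda_my}{2c\sigma^2}\right)dy\right)\right\}.$$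
   Context: Fix constants $T,\sigma,c>0$ and $x_0\in\mathbb{R}$. Let $f_0$ be the density of $\mathcal{N}(x_0,\sigma^2T)$. "Increasing" is understood in the weak sense. A reward function is a function $R(x,r,m):\mathbb{R}\times[0,1]\times\mathbb{R}\to\mathbb{R}\cup\{\pm\infty\}$ that is increasing in all arguments, real-valued if $r\in(0,1)$, and satisfies $\int_0^1R(x,r,m)\,dr<\infty$ for all $(x,m)\in\mathbb{R}^2$. For a probability measure $\mu$ on $\mathbb{R}$ with c.d.f. $F_\mu$, write $R_\mu(x)=R\left(x,F_\mu(x),\int_{\mathbb{R}}y\,d\mu(y)\right)$. The optimal centralized welfare (a principal prescribes and enforces the same effort for all players) is $$V_c:=\sup_{a}E\left[R_{\mathcal{L}(X_T)}(X_T)-\int_0^Tca_t^2\,dt\right],\qquad X_t=x_0+\int_0^ta_s\,ds+\sigma B_t,$$ where $B$ is a standard Brownian motion, $a$ is the effort process and $\mathcal{L}(X_T)$ is the law of $X_T$. It is understood in the weak formulation: efforts $a$ are identified with probability measures $Q$ on $C([0,T],\mathbb{R})$ (laws of $X$) that are equivalent to the law $P$ of $(x_0+\sigma B_t)_{t\in[0,T]}$, and the expected cost of effort is $E^Q\int_0^Tca_t^2\,dt=2c\sigma^2H(Q|P)$, with $H(Q|P)=E^Q[\ln(dQ/dP)]$ the relative entropy.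
   Formalization: λ_m need not exist (for R=x³ every normalizing integral is infinite), so optimality of μ(m) is stated for any m with a λ_m solving the equation, the last formula when λ_m exists for all m; existence is proved if the set of λ with finite normalizing integral is nonempty and open. *)

theory Defs
  imports "HOL-Probability.Probability"
begin

text \<open>
  Integral of an extended-real function: the difference of the integrals of the positive and
  the negative part, with the usual control-theoretic convention \<open>\<infinity> - \<infinity> = -\<infinity>\<close>. The Bochner integral
  is unsuitable here because it is \<open>0\<close> on functions that are not integrable.
\<close>

definition ext_integral :: "'a measure \<Rightarrow> ('a \<Rightarrow> ereal) \<Rightarrow> ereal" where
  "ext_integral M h =
    (if (\<integral>\<^sup>+ x. e2ennreal (- h x) \<partial>M) = \<infinity> then - \<infinity>
     else enn2ereal (\<integral>\<^sup>+ x. e2ennreal (h x) \<partial>M) - enn2ereal (\<integral>\<^sup>+ x. e2ennreal (- h x) \<partial>M))"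

definition equivalent_probs :: "'a measure \<Rightarrow> 'a measure set" where
  "equivalent_probs P =
    {Q. prob_space Q \<and> sets Q = sets P \<and> absolutely_continuous P Q \<and> absolutely_continuous Q P}"

definition log_density :: "'a measure \<Rightarrow> 'a measure \<Rightarrow> 'a \<Rightarrow> real" where
  "log_density P Q x = ln (enn2real (RN_deriv P Q x))"

text \<open>\<open>H(Q|P)\<close> for \<open>Q\<close> equivalent to \<open>P\<close>; the negative part is always integrable.\<close>

definition relative_entropy :: "'a measure \<Rightarrow> 'a measure \<Rightarrow> ereal" where
  "relative_entropy Q P = ext_integral Q (\<lambda>x. ereal (log_density P Q x))"

text \<open>
  \<open>C([0,T])\<close> with the sigma-algebra generated by the coordinate maps, which is the Borel
  sigma-algebra of the uniform topology. Paths are \<^const>\<open>undefined\<close> outside \<open>[0,T]\<close>.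
\<close>

definition path_space :: "real \<Rightarrow> (real \<Rightarrow> real) measure" where
  "path_space T = restrict_space (PiM {0..T} (\<lambda>_. borel)) {w. continuous_on {0..T} w}"

definition standard_brownian_motion :: "real \<Rightarrow> 'w measure \<Rightarrow> (real \<Rightarrow> 'w \<Rightarrow> real) \<Rightarrow> bool" where
  "standard_brownian_motion T M B \<longleftrightarrow>
    prob_space M \<and>
    (\<forall>t\<in>{0..T}. B t \<in> borel_measurable M) \<and>
    (\<forall>w\<in>space M. B 0 w = 0 \<and> continuous_on {0..T} (\<lambda>t. B t w)) \<and>
    (\<forall>s t. 0 \<le> s \<and> s < t \<and> t \<le> T \<longrightarrow>
      distr M borel (\<lambda>w. B t w - B s w) = density lborel (normal_density 0 (sqrt (t - s)))) \<and>
    (\<forall>(n::nat) u. (\<forall>i\<le>n. u i \<in> {0..T}) \<and> (\<forall>i<n. u i < u (Suc i)) \<longrightarrow>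
      prob_space.indep_vars M (\<lambda>_. borel) (\<lambda>i w. B (u (Suc i)) w - B (u i) w) {..<n})"

definition scaled_path_law ::
    "real \<Rightarrow> real \<Rightarrow> real \<Rightarrow> 'w measure \<Rightarrow> (real \<Rightarrow> 'w \<Rightarrow> real) \<Rightarrow> (real \<Rightarrow> real) measure" where
  "scaled_path_law T \<sigma> x0 M B =
    distr M (path_space T) (\<lambda>w. \<lambda>t\<in>{0..T}. x0 + \<sigma> * B t w)"

text \<open>
  The bound on the integral over the rank is read as integrability of the positive part; the
  integral itself may be \<open>-\<infinity>\<close>.
\<close>

definition reward_function :: "(real \<Rightarrow> real \<Rightarrow> real \<Rightarrow> ereal) \<Rightarrow> bool" where
  "reward_function R \<longleftrightarrow>
    (\<forall>x x' r r' m m'. x \<le> x' \<and> 0 \<le> r \<and> r \<le> r' \<and> r' \<le> 1 \<and> m \<le> m' \<longrightarrow> R x r m \<le> R x' r' m') \<and>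
    (\<forall>x r m. 0 < r \<and> r < 1 \<longrightarrow> \<bar>R x r m\<bar> \<noteq> \<infinity>) \<and>
    (\<forall>x m. (\<integral>\<^sup>+ r\<in>{0..1}. e2ennreal (R x r m) \<partial>lborel) < \<infinity>)"

definition induced_reward ::
    "(real \<Rightarrow> real \<Rightarrow> real \<Rightarrow> ereal) \<Rightarrow> real measure \<Rightarrow> real \<Rightarrow> ereal" where
  "induced_reward R \<mu> x = R x (cdf \<mu> x) (\<integral>y. y \<partial>\<mu>)"

text \<open>
  Expected reward minus expected cost of effort under the law \<open>Q\<close> of the state process. Efforts
  of infinite expected cost have welfare \<open>-\<infinity>\<close> (this also avoids \<open>\<infinity> - \<infinity> = \<infinity>\<close> on \<^typ>\<open>ereal\<close>).
  If the relative entropy is finite then the terminal value is automatically \<open>Q\<close>-integrable, since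
  it is Gaussian under \<open>P\<close>, so the mean entering the reward is then well defined.
\<close>

definition welfare ::
    "real \<Rightarrow> real \<Rightarrow> real \<Rightarrow> (real \<Rightarrow> real \<Rightarrow> real \<Rightarrow> ereal) \<Rightarrow> (real \<Rightarrow> real) measure
      \<Rightarrow> (real \<Rightarrow> real) measure \<Rightarrow> ereal" where
  "welfare T \<sigma> c R P Q =
    (if relative_entropy Q P = \<infinity> then - \<infinity>
     else ext_integral Q (\<lambda>w. induced_reward R (distr Q borel (\<lambda>w. w T)) (w T))
            - ereal (2 * c * \<sigma>\<^sup>2) * relative_entropy Q P)"

definition centralized_welfare ::
    "real \<Rightarrow> real \<Rightarrow> real \<Rightarrow> (real \<Rightarrow> real \<Rightarrow> real \<Rightarrow> ereal) \<Rightarrow> (real \<Rightarrow> real) measure \<Rightarrow> ereal" where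
  "centralized_welfare T \<sigma> c R P = (SUP Q\<in>equivalent_probs P. welfare T \<sigma> c R P Q)"

definition equivalent_probs_mean :: "real measure \<Rightarrow> real \<Rightarrow> real measure set" where
  "equivalent_probs_mean N m =
    {\<mu> \<in> equivalent_probs N. integrable \<mu> (\<lambda>y. y) \<and> (\<integral>y. y \<partial>\<mu>) = m}"

definition gibbs_weight ::
    "real \<Rightarrow> (real \<Rightarrow> real) \<Rightarrow> (real \<Rightarrow> real) \<Rightarrow> real \<Rightarrow> real \<Rightarrow> real" where
  "gibbs_weight k f0 g l x = f0 x * exp ((g x - l * x) / k)"

text \<open>The equation determining the multiplier includes finiteness of the two integrals.\<close>

definition mean_multiplier ::
    "real \<Rightarrow> (real \<Rightarrow> real) \<Rightarrow> (real \<Rightarrow> real) \<Rightarrow> real \<Rightarrow> real \<Rightarrow> bool" where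
  "mean_multiplier k f0 g m l \<longleftrightarrow>
    integrable lborel (gibbs_weight k f0 g l) \<and>
    integrable lborel (\<lambda>x. x * gibbs_weight k f0 g l x) \<and>
    m = (\<integral>x. x * gibbs_weight k f0 g l x \<partial>lborel) / (\<integral>y. gibbs_weight k f0 g l y \<partial>lborel)"

definition gibbs_measure ::
    "real \<Rightarrow> (real \<Rightarrow> real) \<Rightarrow> (real \<Rightarrow> real) \<Rightarrow> real \<Rightarrow> real measure" where
  "gibbs_measure k f0 g l =
    density lborel
      (\<lambda>x. ennreal (gibbs_weight k f0 g l x / (\<integral>y. gibbs_weight k f0 g l y \<partial>lborel)))"

end

theory Submission
  imports Defs
begin

text \<open>
  The reward of a path law \<open>Q\<close> depends only on the law \<open>\<mu>\<close> of the terminal state, and its cost is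
  the relative entropy \<open>H(Q|P)\<close>. By the data-processing inequality
  (\<open>relative_entropy_distr_le\<close>) \<open>H(Q|P) \<ge> H(\<mu>|N)\<close>, where \<open>N\<close> is the Gaussian terminal law under
  \<open>P\<close>, and equality holds when the density of \<open>Q\<close> is a function of the terminal state alone. So
  the path disappears from the problem; splitting the terminal laws according to their mean \<open>m\<close>
  turns the reward into a function of \<open>x\<close> alone and gives the double supremum.

  One inequality is immediate (\<open>welfare_le_terminal_value\<close>), but the other is delicate: for some
  rewards there are \<open>\<mu>\<close> for which the integral of reward minus log-density is finite while
  \<open>H(\<mu>|N)\<close> is infinite, so that no effort of finite cost produces \<open>\<mu>\<close>. Such a \<open>\<mu>\<close> is approximated by measures with bounded
  density (\<open>bounded_density_approximation\<close>). These may miss the mean \<open>m\<close>, but they can be chosen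
  to overshoot it, and overshooting does no harm because the reward increases with the mean
  (\<open>terminal_value_le_welfare\<close>).

  For fixed \<open>m\<close> the constraint on the mean is handled by a multiplier \<open>l\<close>: adding the term
  \<open>l (x - m)\<close>, whose integral is \<open>0\<close>, turns the objective into a constant minus \<open>k\<close> times the
  entropy relative to the Gibbs measure (\<open>gibbs_variational_principle\<close>). That measure is therefore
  optimal, and the constant \<open>l m + k ln Z\<close> is the value. The multiplier is unique because the mean
  of the Gibbs measure is strictly decreasing in it (\<open>mean_multiplier_unique\<close>), and it exists as
  the minimiser of a convex partition function (\<open>mean_multiplier_exists\<close>).
\<close>

section \<open>Extended integrals\<close>

lemma ext_integral_real:
  "ext_integral M (\<lambda>x. ereal (f x)) =
    (if (\<integral>\<^sup>+ x. ennreal (- f x) \<partial>M) = \<infinity> then - \<infinity>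
     else enn2ereal (\<integral>\<^sup>+ x. ennreal (f x) \<partial>M) - enn2ereal (\<integral>\<^sup>+ x. ennreal (- f x) \<partial>M))"
  by (simp add: ext_integral_def)

lemma ext_integral_mono_AE:
  assumes "AE x in M. f x \<le> g x"
  shows "ext_integral M (\<lambda>x. ereal (f x)) \<le> ext_integral M (\<lambda>x. ereal (g x))"
proof -
  have pos: "(\<integral>\<^sup>+ x. ennreal (f x) \<partial>M) \<le> (\<integral>\<^sup>+ x. ennreal (g x) \<partial>M)"
    by (rule nn_integral_mono_AE, rule eventually_mono[OF assms]) (auto intro: ennreal_leI)
  have neg: "(\<integral>\<^sup>+ x. ennreal (- g x) \<partial>M) \<le> (\<integral>\<^sup>+ x. ennreal (- f x) \<partial>M)"
    by (rule nn_integral_mono_AE, rule eventually_mono[OF assms]) (auto intro: ennreal_leI)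
  show ?thesis
    using pos neg by (auto simp: ext_integral_real less_eq_ennreal.rep_eq top_unique intro!: ereal_minus_mono)
qed

lemma ext_integral_cong_AE:
  assumes "AE x in M. f x = g x"
  shows "ext_integral M (\<lambda>x. ereal (f x)) = ext_integral M (\<lambda>x. ereal (g x))"
  by (rule antisym; rule ext_integral_mono_AE, rule eventually_mono[OF assms]) auto

lemma ext_integral_eq_integral:
  assumes "integrable M f"
  shows "ext_integral M (\<lambda>x. ereal (f x)) = ereal (\<integral>x. f x \<partial>M)"
proof -
  have fin: "(\<integral>\<^sup>+ x. ennreal (f x) \<partial>M) \<noteq> \<infinity>" "(\<integral>\<^sup>+ x. ennreal (- f x) \<partial>M) \<noteq> \<infinity>"
    using assms by (auto simp: real_integrable_def)
  have e: "enn2ereal a = ereal (enn2real a)" if "a \<noteq> \<infinity>" for a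
    using that by (cases a) (auto simp: enn2ereal_ennreal)
  show ?thesis
    using fin by (simp add: ext_integral_real real_lebesgue_integral_def[OF assms] e)
qed

lemma ext_integral_distr:
  assumes "X \<in> measurable M N" and "f \<in> borel_measurable N"
  shows "ext_integral (distr M N X) (\<lambda>x. ereal (f x)) = ext_integral M (\<lambda>w. ereal (f (X w)))"
  using assms by (simp add: ext_integral_real nn_integral_distr)

text \<open>
  An integrable summand cannot change whether a positive part has infinite integral: the two
  integrals differ by at most \<open>\<integral> \<bar>g\<bar>\<close>.
\<close>

lemma nn_integral_add_integrable_eq_top_iff:
  fixes f g :: "'a \<Rightarrow> real"
  assumes [measurable]: "f \<in> borel_measurable M" and g: "integrable M g"
  shows "(\<integral>\<^sup>+ x. ennreal (f x + g x) \<partial>M) = \<infinity> \<longleftrightarrow> (\<integral>\<^sup>+ x. ennreal (f x) \<partial>M) = \<infinity>"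
proof -
  have [measurable]: "g \<in> borel_measurable M" using g by auto
  have gfin: "(\<integral>\<^sup>+ x. ennreal \<bar>g x\<bar> \<partial>M) < \<infinity>"
    using g by (simp add: integrable_iff_bounded)
  have bound: "(\<integral>\<^sup>+ x. ennreal (a x) \<partial>M) \<le> (\<integral>\<^sup>+ x. ennreal (b x) \<partial>M) + (\<integral>\<^sup>+ x. ennreal \<bar>g x\<bar> \<partial>M)"
    if [measurable]: "a \<in> borel_measurable M" "b \<in> borel_measurable M"
      and "\<And>x. a x \<le> b x + \<bar>g x\<bar>" for a b :: "'a \<Rightarrow> real"
  proof -
    have "(\<integral>\<^sup>+ x. ennreal (a x) \<partial>M) \<le> (\<integral>\<^sup>+ x. ennreal (b x) + ennreal \<bar>g x\<bar> \<partial>M)"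
    proof (rule nn_integral_mono)
      fix x
      have "ennreal (a x) \<le> ennreal (max 0 (b x) + \<bar>g x\<bar>)"
        using that(3)[of x] by (intro ennreal_leI) auto
      also have "\<dots> = ennreal (max 0 (b x)) + ennreal \<bar>g x\<bar>"
        by (rule ennreal_plus) auto
      also have "ennreal (max 0 (b x)) = ennreal (b x)"
        by (auto simp: max_def ennreal_neg)
      finally show "ennreal (a x) \<le> ennreal (b x) + ennreal \<bar>g x\<bar>" .
    qed
    then show ?thesis by (simp add: nn_integral_add)
  qed
  have "(\<integral>\<^sup>+ x. ennreal (f x + g x) \<partial>M) \<le> (\<integral>\<^sup>+ x. ennreal (f x) \<partial>M) + (\<integral>\<^sup>+ x. ennreal \<bar>g x\<bar> \<partial>M)"
    by (rule bound) auto
  moreover have "(\<integral>\<^sup>+ x. ennreal (f x) \<partial>M) \<le> (\<integral>\<^sup>+ x. ennreal (f x + g x) \<partial>M) + (\<integral>\<^sup>+ x. ennreal \<bar>g x\<bar> \<partial>M)"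
    by (rule bound) (auto simp: abs_if)
  moreover have "(\<integral>\<^sup>+ x. ennreal \<bar>g x\<bar> \<partial>M) \<noteq> \<infinity>" using gfin by simp
  ultimately show ?thesis
    by (auto simp: top_unique ennreal_add_eq_top)
qed

text \<open>
  This is what allows a finite entropy cost to be moved in and out of the integral of a reward
  that need not be integrable.
\<close>

lemma ext_integral_add_integrable:
  fixes f g :: "'a \<Rightarrow> real"
  assumes f[measurable]: "f \<in> borel_measurable M" and g: "integrable M g"
  shows "ext_integral M (\<lambda>x. ereal (f x + g x)) =
    ext_integral M (\<lambda>x. ereal (f x)) + ereal (\<integral>x. g x \<partial>M)"
proof -
  have neg: "(\<integral>\<^sup>+ x. ennreal (- (f x + g x)) \<partial>M) = \<infinity> \<longleftrightarrow> (\<integral>\<^sup>+ x. ennreal (- f x) \<partial>M) = \<infinity>"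
    using nn_integral_add_integrable_eq_top_iff[of "\<lambda>x. - f x" M "\<lambda>x. - g x"] g by simp
  have pos: "(\<integral>\<^sup>+ x. ennreal (f x + g x) \<partial>M) = \<infinity> \<longleftrightarrow> (\<integral>\<^sup>+ x. ennreal (f x) \<partial>M) = \<infinity>"
    by (rule nn_integral_add_integrable_eq_top_iff[OF f g])
  show ?thesis
  proof (cases "(\<integral>\<^sup>+ x. ennreal (- f x) \<partial>M) = \<infinity> \<or> (\<integral>\<^sup>+ x. ennreal (f x) \<partial>M) = \<infinity>")
    case True
    have e: "enn2ereal \<infinity> - enn2ereal a = \<infinity>" if "a \<noteq> \<infinity>" for a
      using that by (cases a) (simp_all add: enn2ereal_ennreal)
    show ?thesis
    proof (cases "(\<integral>\<^sup>+ x. ennreal (- f x) \<partial>M) = \<infinity>")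
      case True
      then show ?thesis using neg by (simp only: ext_integral_real if_True simp_thms) simp
    next
      case neg_f: False
      then have pos_f: "(\<integral>\<^sup>+ x. ennreal (f x) \<partial>M) = \<infinity>" using True by blast
      then show ?thesis
        using neg_f neg pos by (simp only: ext_integral_real e if_False simp_thms) simp
    qed
  next
    case False
    then have "integrable M f" by (auto simp: real_integrable_def)
    with g show ?thesis by (simp add: ext_integral_eq_integral)
  qed
qed

section \<open>Equivalent measures and relative entropy\<close>

text \<open>
  Densities are taken to be positive everywhere, not just almost everywhere, so that logarithms
  and quotients of densities need no exceptional sets. Changing a version on a null set makes
  this possible for every equivalent measure (\<open>equivalent_probs_eq\<close>).
\<close>

definition positive_density :: "'a measure \<Rightarrow> ('a \<Rightarrow> real) \<Rightarrow> bool" where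
  "positive_density P q \<longleftrightarrow> (\<forall>x. 0 < q x) \<and> integrable P q \<and> (\<integral>x. q x \<partial>P) = 1"

lemma positive_densityD:
  assumes "positive_density P q"
  shows "q \<in> borel_measurable P" "0 < q x" "integrable P q" "(\<integral>x. q x \<partial>P) = 1"
  using assms by (auto simp: positive_density_def)

lemma prob_space_positive_density:
  assumes "positive_density P q"
  shows "prob_space (density P (\<lambda>x. ennreal (q x)))"
proof
  note [measurable] = positive_densityD(1)[OF assms]
  have "(\<integral>\<^sup>+ x. ennreal (q x) \<partial>P) = 1"
    using positive_densityD[OF assms] by (subst nn_integral_eq_integral) (auto intro: less_imp_le)
  then show "emeasure (density P (\<lambda>x. ennreal (q x))) (space (density P (\<lambda>x. ennreal (q x)))) = 1"
    by (simp add: emeasure_density cong: nn_integral_cong)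
qed

lemma AE_positive_density:
  assumes "positive_density P q"
  shows "(AE x in density P (\<lambda>x. ennreal (q x)). A x) \<longleftrightarrow> (AE x in P. A x)"
  using positive_densityD[OF assms] by (simp add: AE_density)

lemma positive_density_integral:
  fixes f :: "'a \<Rightarrow> real"
  assumes q: "positive_density P q" and f: "f \<in> borel_measurable P"
  shows "integrable (density P (\<lambda>x. ennreal (q x))) f \<longleftrightarrow> integrable P (\<lambda>x. q x * f x)"
    and "(\<integral>x. f x \<partial>density P (\<lambda>x. ennreal (q x))) = (\<integral>x. q x * f x \<partial>P)"
  using positive_densityD(2)[OF q]
    integrable_density[OF f positive_densityD(1)[OF q]] integral_density[OF f positive_densityD(1)[OF q]]
  by (simp_all add: less_imp_le)

lemma equivalent_probs_eq:
  assumes "prob_space P"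
  shows "equivalent_probs P = (\<lambda>q. density P (\<lambda>x. ennreal (q x))) ` {q. positive_density P q}"
proof (intro equalityI subsetI)
  interpret P: prob_space P by fact
  fix Q assume "Q \<in> equivalent_probs P"
  then have Q: "prob_space Q" "sets Q = sets P" "absolutely_continuous P Q" "absolutely_continuous Q P"
    by (auto simp: equivalent_probs_def)
  interpret Q: prob_space Q by fact
  define r where "r = RN_deriv P Q"
  define q where "q x = (if enn2real (r x) = 0 then 1 else enn2real (r x))" for x
  have [measurable]: "r \<in> borel_measurable P" by (simp add: r_def)
  have [measurable]: "q \<in> borel_measurable P" unfolding q_def by measurable
  have Qr: "density P r = Q"
    unfolding r_def using Q by (intro P.density_RN_deriv) auto
  have fin: "AE x in P. r x \<noteq> \<infinity>"
    unfolding r_def using Q by (intro P.RN_deriv_finite) (auto intro: Q.sigma_finite_measure_axioms)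
  have "{x\<in>space P. r x = 0} \<in> null_sets Q"
    unfolding Qr[symmetric] by (subst null_sets_density_iff) (auto)
  then have "{x\<in>space P. r x = 0} \<in> null_sets P"
    using Q(4) by (auto simp: absolutely_continuous_def)
  then have nz: "AE x in P. r x \<noteq> 0"
    by (auto intro!: AE_I')
  have qr: "AE x in P. ennreal (q x) = r x"
    using fin nz by eventually_elim (auto simp: q_def enn2real_eq_0_iff less_top)
  then have Qq: "Q = density P (\<lambda>x. ennreal (q x))"
    unfolding Qr[symmetric] by (intro density_cong) auto
  have qpos: "0 < q x" for x by (simp add: q_def enn2real_positive_iff order_less_le)
  have "(\<integral>\<^sup>+ x. ennreal (q x) \<partial>P) = 1"
    using Q.emeasure_space_1 unfolding Qq by (simp add: emeasure_density cong: nn_integral_cong)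
  then have "has_bochner_integral P q 1"
    using qpos by (intro has_bochner_integral_nn_integral) (auto intro: less_imp_le)
  with qpos have "positive_density P q"
    by (auto simp: positive_density_def has_bochner_integral_iff)
  with Qq show "Q \<in> (\<lambda>q. density P (\<lambda>x. ennreal (q x))) ` {q. positive_density P q}" by auto
next
  interpret P: prob_space P by fact
  fix Q assume "Q \<in> (\<lambda>q. density P (\<lambda>x. ennreal (q x))) ` {q. positive_density P q}"
  then obtain q where Q: "Q = density P (\<lambda>x. ennreal (q x))" and q: "positive_density P q" by auto
  have "A \<in> null_sets P \<longleftrightarrow> A \<in> null_sets Q" for A
  proof (cases "A \<in> sets P")
    case True
    then show ?thesis
      using AE_positive_density[OF q, of "\<lambda>x. x \<notin> A"] by (simp add: Q AE_iff_null_sets)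
  qed (auto simp: Q)
  with q show "Q \<in> equivalent_probs P"
    by (simp add: equivalent_probs_def absolutely_continuous_def Q prob_space_positive_density)
       (auto simp: Q)
qed

lemma log_density_positive_density:
  assumes "prob_space P" and q: "positive_density P q"
  shows "AE x in density P (\<lambda>x. ennreal (q x)).
    log_density P (density P (\<lambda>x. ennreal (q x))) x = ln (q x)"
proof -
  interpret P: prob_space P by fact
  note [measurable] = positive_densityD(1)[OF q]
  interpret Q: prob_space "density P (\<lambda>x. ennreal (q x))"
    using prob_space_positive_density[OF q] .
  have "AE x in P. ennreal (q x) = RN_deriv P (density P (\<lambda>x. ennreal (q x))) x"
    by (rule P.RN_deriv_unique) auto
  then show ?thesis
    unfolding AE_positive_density[OF q] log_density_def
  proof eventually_elim
    case (elim x)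
    then show ?case using positive_densityD(2)[OF q, of x] by (simp flip: elim)
  qed
qed

text \<open>
  The inequality behind every entropy estimate below. Integrated against the measure with
  density \<open>q\<close>, the ratio \<open>f / q\<close> contributes just \<open>\<integral> f
  \<partial>P\<close>, so \<open>ln f\<close> is controlled by the entropy of \<open>q\<close>:
  with \<open>f\<close> a probability density this is Gibbs' inequality, with \<open>f = exp
  \<bar>X\<bar>\<close> it bounds moments of \<open>X\<close>.
\<close>

lemma ln_le_ln_plus_ratio:
  fixes f q :: real
  assumes "0 < f" "0 < q"
  shows "ln f \<le> ln q + f / q - 1"
  using ln_le_minus_one[of "f / q"] assms by (simp add: ln_div)

lemma integral_ratio_density:
  fixes f q :: "'a \<Rightarrow> real"
  assumes q: "positive_density P q" and f: "integrable P f"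
  shows "integrable (density P (\<lambda>x. ennreal (q x))) (\<lambda>x. f x / q x)"
    and "(\<integral>x. f x / q x \<partial>density P (\<lambda>x. ennreal (q x))) = (\<integral>x. f x \<partial>P)"
proof -
  note [measurable] = positive_densityD(1)[OF q] borel_measurable_integrable[OF f]
  have eq: "q x * (f x / q x) = f x" for x using positive_densityD(2)[OF q, of x] by simp
  show "integrable (density P (\<lambda>x. ennreal (q x))) (\<lambda>x. f x / q x)"
    using f positive_densityD(2)[OF q]
    by (subst integrable_density) (simp_all add: eq less_imp_le del: times_divide_eq_right)
  show "(\<integral>x. f x / q x \<partial>density P (\<lambda>x. ennreal (q x))) = (\<integral>x. f x \<partial>P)"
    using positive_densityD(2)[OF q]
    by (subst integral_density) (simp_all add: eq less_imp_le del: times_divide_eq_right)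
qed

lemma relative_entropy_density:
  assumes P: "prob_space P" and q: "positive_density P q"
  shows "relative_entropy (density P (\<lambda>x. ennreal (q x))) P =
    ext_integral (density P (\<lambda>x. ennreal (q x))) (\<lambda>x. ereal (ln (q x)))"
  unfolding relative_entropy_def
  by (rule ext_integral_cong_AE[OF log_density_positive_density[OF P q]])

text \<open>
  The negative part of \<open>ln q\<close> is at most \<open>1 / q\<close>, whose integral
  against \<open>q \<cdot> P\<close> is \<open>1\<close>; hence only the positive part could
  prevent integrability.
\<close>

lemma integrable_log_density:
  assumes P: "prob_space P" and q: "positive_density P q"
    and fin: "relative_entropy (density P (\<lambda>x. ennreal (q x))) P \<noteq> \<infinity>"
  shows "integrable (density P (\<lambda>x. ennreal (q x))) (\<lambda>x. ln (q x))"
proof -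
  let ?Q = "density P (\<lambda>x. ennreal (q x))"
  interpret P: prob_space P by fact
  note [measurable] = positive_densityD(1)[OF q]
  have r: "integrable ?Q (\<lambda>x. 1 / q x)" by (rule integral_ratio_density[OF q]) simp
  have "(\<integral>\<^sup>+ x. ennreal (- ln (q x)) \<partial>?Q) \<le> (\<integral>\<^sup>+ x. ennreal (1 / q x) \<partial>?Q)"
  proof (intro nn_integral_mono ennreal_leI)
    fix x show "- ln (q x) \<le> 1 / q x"
      using ln_le_ln_plus_ratio[of 1 "q x"] positive_densityD(2)[OF q, of x] by simp
  qed
  also have "\<dots> < \<infinity>" using r positive_densityD(2)[OF q]
    by (subst nn_integral_eq_integral) (auto intro: less_imp_le)
  finally have neg: "(\<integral>\<^sup>+ x. ennreal (- ln (q x)) \<partial>?Q) \<noteq> \<infinity>" by simp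
  moreover have "(\<integral>\<^sup>+ x. ennreal (ln (q x)) \<partial>?Q) \<noteq> \<infinity>"
  proof
    assume top: "(\<integral>\<^sup>+ x. ennreal (ln (q x)) \<partial>?Q) = \<infinity>"
    show False using fin neg unfolding relative_entropy_density[OF P q] ext_integral_real top
      by (cases "\<integral>\<^sup>+ x. ennreal (- ln (q x)) \<partial>?Q") (auto simp: enn2ereal_ennreal)
  qed
  ultimately show ?thesis by (auto simp: real_integrable_def)
qed

section \<open>Relative entropy under projections\<close>

text \<open>
  A density that depends on the path through its terminal value realises a prescribed terminal
  law, and it does so with no more entropy than that law has.
\<close>

lemma positive_density_pullback:
  assumes X[measurable]: "X \<in> measurable P S" and g: "positive_density (distr P S X) g"
  shows "positive_density P (\<lambda>w. g (X w))"
    and "distr (density P (\<lambda>w. ennreal (g (X w)))) S X = density (distr P S X) (\<lambda>x. ennreal (g x))"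
proof -
  have [measurable]: "g \<in> borel_measurable S"
    using positive_densityD(1)[OF g] by simp
  show "positive_density P (\<lambda>w. g (X w))"
    using positive_densityD[OF g] by (simp add: positive_density_def integrable_distr_eq integral_distr)
  show "distr (density P (\<lambda>w. ennreal (g (X w)))) S X = density (distr P S X) (\<lambda>x. ennreal (g x))"
    by (subst density_distr) auto
qed

lemma distr_equivalent_probs:
  assumes X[measurable]: "X \<in> measurable P S" and Q: "Q \<in> equivalent_probs P"
  shows "distr Q S X \<in> equivalent_probs (distr P S X)"
proof -
  have [measurable_cong]: "sets Q = sets P" using Q by (simp add: equivalent_probs_def)
  have Qsp: "space Q = space P" by (rule sets_eq_imp_space_eq) fact
  interpret Q: prob_space Q using Q by (simp add: equivalent_probs_def)
  have null: "A \<in> null_sets (distr M' S X) \<longleftrightarrow> A \<in> sets S \<and> X -` A \<inter> space M' \<in> null_sets M'"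
    if "X \<in> measurable M' S" for A M'
    using that by (auto simp: null_sets_def emeasure_distr)
  have "null_sets P = null_sets Q"
    using Q by (auto simp: equivalent_probs_def absolutely_continuous_def)
  moreover have "X \<in> measurable Q S" by measurable
  ultimately have "null_sets (distr Q S X) = null_sets (distr P S X)"
    using null[of P] null[of Q] Qsp by auto
  moreover have "prob_space (distr Q S X)"
    by (rule Q.prob_space_distr) measurable
  ultimately show ?thesis
    by (simp add: equivalent_probs_def absolutely_continuous_def)
qed

text \<open>
  The data-processing inequality. It is Gibbs' inequality on the large space between the density
  \<open>q\<close> and the density \<open>h \<circ> X\<close>, which also integrates to
  \<open>1\<close>.
\<close>

lemma relative_entropy_distr_le:
  assumes P: "prob_space P" and X[measurable]: "X \<in> measurable P S"
    and q: "positive_density P q" and h: "positive_density (distr P S X) h"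
    and push: "distr (density P (\<lambda>x. ennreal (q x))) S X = density (distr P S X) (\<lambda>x. ennreal (h x))"
    and int: "integrable (density P (\<lambda>x. ennreal (q x))) (\<lambda>x. ln (q x))"
  shows "integrable (density (distr P S X) (\<lambda>x. ennreal (h x))) (\<lambda>x. ln (h x))"
    and "(\<integral>x. ln (h x) \<partial>density (distr P S X) (\<lambda>x. ennreal (h x))) \<le>
      (\<integral>x. ln (q x) \<partial>density P (\<lambda>x. ennreal (q x)))"
proof -
  let ?Q = "density P (\<lambda>x. ennreal (q x))"
  let ?N = "distr P S X"
  interpret P: prob_space P by fact
  interpret N: prob_space ?N by (rule P.prob_space_distr) fact
  interpret Q: prob_space ?Q using prob_space_positive_density[OF q] .
  note [measurable] = positive_densityD(1)[OF q]
  have [measurable]: "h \<in> borel_measurable S"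
    using positive_densityD(1)[OF h] by simp
  have hX: "integrable P (\<lambda>w. h (X w))" "(\<integral>w. h (X w) \<partial>P) = 1"
    using positive_densityD(3,4)[OF h] by (simp_all add: integrable_distr_eq integral_distr)
  have upper: "integrable ?Q (\<lambda>w. h (X w) / q w)" "(\<integral>w. h (X w) / q w \<partial>?Q) = 1"
    using integral_ratio_density[OF q hX(1)] hX(2) by simp_all
  have "integrable (distr ?Q S X) (\<lambda>x. 1 / h x)"
    unfolding push by (rule integral_ratio_density[OF h]) simp
  then have lower: "integrable ?Q (\<lambda>w. 1 / h (X w))"
    by (simp add: integrable_distr_eq)
  have pos: "0 < q w" "0 < h (X w)" for w
    using positive_densityD(2)[OF q] positive_densityD(2)[OF h] by auto
  have le: "ln (h (X w)) \<le> ln (q w) + h (X w) / q w - 1" for w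
    using pos by (intro ln_le_ln_plus_ratio)
  have ge: "- ln (h (X w)) \<le> 1 / h (X w)" for w
    using ln_le_ln_plus_ratio[of 1 "h (X w)"] pos[of w] by simp
  have i: "integrable ?Q (\<lambda>w. ln (h (X w)))"
  proof (rule Bochner_Integration.integrable_bound)
    show "integrable ?Q (\<lambda>w. \<bar>ln (q w)\<bar> + h (X w) / q w + 1 / h (X w))"
      using int upper lower by auto
    show "AE w in ?Q. norm (ln (h (X w))) \<le> norm (\<bar>ln (q w)\<bar> + h (X w) / q w + 1 / h (X w))"
    proof (rule AE_I2)
      fix w
      have "0 \<le> h (X w) / q w" "0 \<le> 1 / h (X w)" using pos[of w] by (auto intro: less_imp_le)
      then show "norm (ln (h (X w))) \<le> norm (\<bar>ln (q w)\<bar> + h (X w) / q w + 1 / h (X w))"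
        using le[of w] ge[of w] unfolding real_norm_def by linarith
    qed
  qed simp
  then show "integrable (density ?N (\<lambda>x. ennreal (h x))) (\<lambda>x. ln (h x))"
    unfolding push[symmetric] by (simp add: integrable_distr_eq)
  have "(\<integral>x. ln (h x) \<partial>density ?N (\<lambda>x. ennreal (h x))) = (\<integral>w. ln (h (X w)) \<partial>?Q)"
    unfolding push[symmetric] by (simp add: integral_distr)
  also have "\<dots> \<le> (\<integral>w. ln (q w) + h (X w) / q w - 1 \<partial>?Q)"
    using le i int upper(1) by (intro integral_mono) auto
  also have "\<dots> = (\<integral>x. ln (q x) \<partial>?Q)"
    using int upper Q.prob_space by simp
  finally show "(\<integral>x. ln (h x) \<partial>density ?N (\<lambda>x. ennreal (h x))) \<le> (\<integral>x. ln (q x) \<partial>?Q)" .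
qed

text \<open>
  A law of finite entropy relative to \<open>P\<close> has finite first moment as soon as
  \<open>P\<close> has an exponential moment, because \<open>\<bar>X\<bar> \<le> ln q + exp
  \<bar>X\<bar> / q\<close>. For the Gaussian reference law this makes the mean that enters the
  reward well defined.
\<close>

lemma integrable_of_exp_moment:
  fixes X :: "'a \<Rightarrow> real"
  assumes q: "positive_density P q"
    and int: "integrable (density P (\<lambda>x. ennreal (q x))) (\<lambda>x. ln (q x))"
    and X[measurable]: "X \<in> borel_measurable P" and e: "integrable P (\<lambda>w. exp \<bar>X w\<bar>)"
  shows "integrable (density P (\<lambda>x. ennreal (q x))) X"
proof (rule Bochner_Integration.integrable_bound)
  let ?Q = "density P (\<lambda>x. ennreal (q x))"
  show "integrable ?Q (\<lambda>w. ln (q w) + exp \<bar>X w\<bar> / q w)"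
    using int integral_ratio_density(1)[OF q e] by auto
  have "\<bar>X w\<bar> \<le> ln (q w) + exp \<bar>X w\<bar> / q w - 1" for w
    using ln_le_ln_plus_ratio[of "exp \<bar>X w\<bar>" "q w"] positive_densityD(2)[OF q, of w] by simp
  then show "AE w in ?Q. norm (X w) \<le> norm (ln (q w) + exp \<bar>X w\<bar> / q w)"
    by (intro AE_I2) (smt (verit) real_norm_def)
qed simp

section \<open>The law of the terminal state\<close>

lemma exp_abs_le: "exp \<bar>x\<bar> \<le> exp (- x) + exp x" for x :: real
  by (cases "0 \<le> x") simp_all

lemma integrable_exp_abs_normal:
  assumes "0 < s"
  shows "integrable (density lborel (\<lambda>x. ennreal (normal_density b s x))) (\<lambda>x. exp \<bar>x\<bar>)"
proof -
  \<comment> \<open>Completing the square: exponential tilting translates a Gaussian density.\<close>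
  have shift: "normal_density b s x * exp (t * x) =
      exp (t * b + t\<^sup>2 * s\<^sup>2 / 2) * normal_density (b + t * s\<^sup>2) s x" for t x
  proof -
    have "- (x - b)\<^sup>2 / (2 * s\<^sup>2) + t * x =
        (t * b + t\<^sup>2 * s\<^sup>2 / 2) + - (x - (b + t * s\<^sup>2))\<^sup>2 / (2 * s\<^sup>2)"
      using assms by (simp add: field_simps power2_eq_square)
    then show ?thesis
      unfolding normal_density_def by (simp add: exp_add[symmetric] mult_ac)
  qed
  have "integrable lborel (\<lambda>x. normal_density b s x * exp (t * x))" for t
    unfolding shift using assms by (intro integrable_mult_right integrable_normal_density)
  from this[of 1] this[of "-1"]
  have "integrable lborel (\<lambda>x. normal_density b s x * exp x + normal_density b s x * exp (- x))"
    by auto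
  then have "integrable lborel (\<lambda>x. normal_density b s x * exp \<bar>x\<bar>)"
  proof (rule Bochner_Integration.integrable_bound)
    from mult_left_mono[OF exp_abs_le normal_density_nonneg]
    show "AE x in lborel. norm (normal_density b s x * exp \<bar>x\<bar>) \<le>
        norm (normal_density b s x * exp x + normal_density b s x * exp (- x))"
      by (intro AE_I2) (simp add: distrib_left add.commute)
  qed simp
  then show ?thesis
    by (simp add: integrable_density)
qed

lemma terminal_law:
  fixes x0 :: real
  assumes T: "T > 0" and \<sigma>: "\<sigma> > 0" and B: "standard_brownian_motion T M B"
  defines "P \<equiv> scaled_path_law T \<sigma> x0 M B"
  shows "prob_space P" and "(\<lambda>w. w T) \<in> borel_measurable P"
    and "distr P borel (\<lambda>w. w T) = density lborel (\<lambda>x. ennreal (normal_density x0 (\<sigma> * sqrt T) x))"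
proof -
  let ?X = "\<lambda>w. \<lambda>t\<in>{0..T}. x0 + \<sigma> * B t w"
  interpret M: prob_space M using B by (simp add: standard_brownian_motion_def)
  have Bm: "B t \<in> borel_measurable M" if "t \<in> {0..T}" for t
    using B that by (simp add: standard_brownian_motion_def)
  have B0: "B 0 w = 0" and Bc: "continuous_on {0..T} (\<lambda>t. B t w)" if "w \<in> space M" for w
    using B that by (auto simp: standard_brownian_motion_def)
  have [measurable]: "?X \<in> measurable M (path_space T)"
    unfolding path_space_def
  proof (rule measurable_restrict_space2)
    show "?X \<in> space M \<rightarrow> {w. continuous_on {0..T} w}"
    proof safe
      fix w assume "w \<in> space M"
      then have "continuous_on {0..T} (\<lambda>t. x0 + \<sigma> * B t w)"
        by (intro continuous_intros Bc)
      then show "continuous_on {0..T} (?X w)"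
        by (rule continuous_on_eq) simp
    qed
    show "?X \<in> measurable M (PiM {0..T} (\<lambda>_. borel))"
      using Bm by (intro measurable_restrict) auto
  qed
  have [measurable]: "(\<lambda>w. w T) \<in> borel_measurable (path_space T)"
    unfolding path_space_def using T
    by (intro measurable_restrict_space1 measurable_component_singleton) auto
  show "prob_space P"
    unfolding P_def scaled_path_law_def by (rule M.prob_space_distr) measurable
  show "(\<lambda>w. w T) \<in> borel_measurable P"
    unfolding P_def scaled_path_law_def by measurable
  have BT: "distr M borel (\<lambda>w. B T w) = density lborel (normal_density 0 (sqrt T))"
  proof -
    have "\<forall>s t. 0 \<le> s \<and> s < t \<and> t \<le> T \<longrightarrow>
      distr M borel (\<lambda>w. B t w - B s w) = density lborel (normal_density 0 (sqrt (t - s)))"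
      using B by (simp add: standard_brownian_motion_def)
    from this[rule_format, of 0 T]
    have "distr M borel (\<lambda>w. B T w - B 0 w) = density lborel (normal_density 0 (sqrt T))"
      using T by simp
    moreover have "distr M borel (\<lambda>w. B T w - B 0 w) = distr M borel (\<lambda>w. B T w)"
      using B0 by (intro distr_cong) auto
    ultimately show ?thesis by simp
  qed
  have "distributed M lborel (\<lambda>w. B T w) (normal_density 0 (sqrt T))"
    using BT Bm[of T] T by (auto simp: distributed_def cong: distr_cong)
  from M.normal_density_affine[OF this, of \<sigma> x0]
  have "distributed M lborel (\<lambda>w. x0 + \<sigma> * B T w) (normal_density x0 (\<sigma> * sqrt T))"
    using T \<sigma> by simp
  then have "distr M borel (\<lambda>w. x0 + \<sigma> * B T w) = density lborel (normal_density x0 (\<sigma> * sqrt T))"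
    by (auto simp: distributed_def cong: distr_cong)
  moreover have "distr P borel (\<lambda>w. w T) = distr M borel (\<lambda>w. x0 + \<sigma> * B T w)"
    unfolding P_def scaled_path_law_def using T by (simp add: distr_distr comp_def)
  ultimately show "distr P borel (\<lambda>w. w T) = density lborel (\<lambda>x. ennreal (normal_density x0 (\<sigma> * sqrt T) x))"
    by simp
qed

section \<open>Welfare in terms of the terminal law\<close>

lemma cdf_bounds:
  assumes "prob_space \<mu>"
  shows "0 \<le> cdf \<mu> x" "cdf \<mu> x \<le> 1"
  using assms by (auto simp: cdf_def prob_space.prob_le_1)

text \<open>
  Only finite costs are considered here, so reward and cost can be collected under a single
  integral.
\<close>

lemma welfare_positive_density:
  assumes P: "prob_space P" and X[measurable]: "(\<lambda>w. w T) \<in> borel_measurable P"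
    and R: "\<And>x r m. 0 \<le> r \<Longrightarrow> r \<le> 1 \<Longrightarrow> R x r m = ereal (\<rho> x m)"
    and \<rho>[measurable]: "\<And>m. (\<lambda>x. \<rho> x m) \<in> borel_measurable borel"
    and q: "positive_density P q"
    and int: "integrable (density P (\<lambda>w. ennreal (q w))) (\<lambda>w. ln (q w))"
  defines "Q \<equiv> density P (\<lambda>w. ennreal (q w))"
  shows "welfare T \<sigma> c R P Q =
    ext_integral Q (\<lambda>w. ereal (\<rho> (w T) (\<integral>w. w T \<partial>Q) - 2 * c * \<sigma>\<^sup>2 * ln (q w)))"
proof -
  interpret Q: prob_space Q unfolding Q_def using prob_space_positive_density[OF q] .
  have XQ[measurable]: "(\<lambda>w. w T) \<in> borel_measurable Q" by (simp add: Q_def)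
  have \<mu>: "prob_space (distr Q borel (\<lambda>w. w T))" by (rule Q.prob_space_distr) measurable
  have H: "relative_entropy Q P = ereal (\<integral>w. ln (q w) \<partial>Q)"
    using relative_entropy_density[OF P q] ext_integral_eq_integral[OF int] by (simp add: Q_def)
  have mean: "(\<integral>y. y \<partial>distr Q borel (\<lambda>w. w T)) = (\<integral>w. w T \<partial>Q)"
    by (simp add: integral_distr)
  have r: "induced_reward R (distr Q borel (\<lambda>w. w T)) x = ereal (\<rho> x (\<integral>w. w T \<partial>Q))" for x
    by (simp add: induced_reward_def R cdf_bounds[OF \<mu>] mean)
  have "ext_integral Q (\<lambda>w. ereal (\<rho> (w T) (\<integral>w. w T \<partial>Q) + - (2 * c * \<sigma>\<^sup>2 * ln (q w)))) =
    ext_integral Q (\<lambda>w. ereal (\<rho> (w T) (\<integral>w. w T \<partial>Q))) + ereal (\<integral>w. - (2 * c * \<sigma>\<^sup>2 * ln (q w)) \<partial>Q)"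
    using int unfolding Q_def[symmetric] by (intro ext_integral_add_integrable) auto
  then show ?thesis
    by (simp add: welfare_def H r minus_ereal_def)
qed

text \<open>
  Passing from a path law to its terminal law keeps the reward and can only lower the entropy
  cost.
\<close>

lemma welfare_le_terminal_value:
  fixes N :: "real measure"
  assumes P: "prob_space P" and X[measurable]: "(\<lambda>w. w T) \<in> borel_measurable P"
    and N: "N = distr P borel (\<lambda>w. w T)" and e: "integrable N (\<lambda>x. exp \<bar>x\<bar>)"
    and R: "\<And>x r m. 0 \<le> r \<Longrightarrow> r \<le> 1 \<Longrightarrow> R x r m = ereal (\<rho> x m)"
    and \<rho>[measurable]: "\<And>m. (\<lambda>x. \<rho> x m) \<in> borel_measurable borel"
    and k: "0 \<le> c"
    and Q: "Q \<in> equivalent_probs P" and fin: "relative_entropy Q P \<noteq> \<infinity>"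
  obtains m \<mu> where "\<mu> \<in> equivalent_probs_mean N m"
    and "welfare T \<sigma> c R P Q \<le>
      ext_integral \<mu> (\<lambda>x. ereal (\<rho> x m - 2 * c * \<sigma>\<^sup>2 * log_density N \<mu> x))"
proof -
  let ?k = "2 * c * \<sigma>\<^sup>2"
  interpret P: prob_space P by fact
  have Np: "prob_space N" unfolding N by (rule P.prob_space_distr) fact
  obtain q where Qq: "Q = density P (\<lambda>w. ennreal (q w))" and q: "positive_density P q"
    using Q equivalent_probs_eq[OF P] by auto
  have int: "integrable Q (\<lambda>w. ln (q w))"
    unfolding Qq using fin by (intro integrable_log_density[OF P q]) (simp add: Qq)
  have [measurable]: "(\<lambda>w. w T) \<in> borel_measurable Q" by (simp add: Qq)
  define \<mu> where "\<mu> = distr Q borel (\<lambda>w. w T)"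
  have \<mu>eq: "\<mu> \<in> equivalent_probs N"
    unfolding \<mu>_def N by (rule distr_equivalent_probs[OF X Q])
  then obtain h where \<mu>h: "\<mu> = density N (\<lambda>x. ennreal (h x))" and h: "positive_density N h"
    using equivalent_probs_eq[OF Np] by auto
  have [measurable]: "h \<in> borel_measurable borel"
    using positive_densityD(1)[OF h] by (simp add: N)
  define m where "m = (\<integral>w. w T \<partial>Q)"
  have "integrable P (\<lambda>w. exp \<bar>w T\<bar>)"
    using e unfolding N by (simp add: integrable_distr_eq)
  then have "integrable Q (\<lambda>w. w T)"
    unfolding Qq using int[unfolded Qq] by (intro integrable_of_exp_moment[OF q _ X])
  then have mem: "\<mu> \<in> equivalent_probs_mean N m"
    using \<mu>eq by (simp add: equivalent_probs_mean_def \<mu>_def m_def integrable_distr_eq integral_distr)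
  have ent: "integrable \<mu> (\<lambda>x. ln (h x))" "(\<integral>x. ln (h x) \<partial>\<mu>) \<le> (\<integral>w. ln (q w) \<partial>Q)"
    using relative_entropy_distr_le[OF P X q, of h] h int \<mu>h
    by (simp_all add: N Qq[symmetric] \<mu>_def)
  have "welfare T \<sigma> c R P Q = ext_integral Q (\<lambda>w. ereal (\<rho> (w T) m + - (?k * ln (q w))))"
    using welfare_positive_density[OF P X R \<rho> q, where \<sigma> = \<sigma> and c = c] int by (simp add: Qq m_def)
  also have "\<dots> = ext_integral Q (\<lambda>w. ereal (\<rho> (w T) m)) + ereal (\<integral>w. - (?k * ln (q w)) \<partial>Q)"
    using int by (intro ext_integral_add_integrable) auto
  also have "ext_integral Q (\<lambda>w. ereal (\<rho> (w T) m)) = ext_integral \<mu> (\<lambda>x. ereal (\<rho> x m))"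
    unfolding \<mu>_def by (rule ext_integral_distr[symmetric]) measurable
  also have "\<dots> + ereal (\<integral>w. - (?k * ln (q w)) \<partial>Q) \<le>
      \<dots> + ereal (\<integral>x. - (?k * ln (h x)) \<partial>\<mu>)"
    using ent k by (intro add_left_mono) (simp add: mult_left_mono)
  also have "\<dots> = ext_integral \<mu> (\<lambda>x. ereal (\<rho> x m + - (?k * ln (h x))))"
    using ent(1) by (intro ext_integral_add_integrable[symmetric]) (auto simp: \<mu>_def)
  also have "\<dots> = ext_integral \<mu> (\<lambda>x. ereal (\<rho> x m - ?k * log_density N \<mu> x))"
    by (rule ext_integral_cong_AE,
        rule eventually_mono[OF log_density_positive_density[OF Np h, folded \<mu>h]]) simp
  finally show ?thesis using mem that by blast
qed

section \<open>Approximation by bounded densities\<close>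

lemma abs_mult_ln_le:
  fixes t :: real
  assumes "0 < t"
  shows "\<bar>t * ln t\<bar> \<le> 1 + t\<^sup>2"
proof -
  have "t * ln t \<le> t * (t - 1)"
    using ln_le_minus_one[OF assms] assms by (intro mult_left_mono) auto
  then have "t * ln t \<le> t\<^sup>2 - t" by (simp add: algebra_simps power2_eq_square)
  moreover have "t * (- ln t) \<le> t * (1 / t - 1)"
    using ln_le_ln_plus_ratio[of 1 t] assms by (intro mult_left_mono) auto
  then have "- (t * ln t) \<le> 1 - t" using assms by (simp add: algebra_simps)
  moreover have "0 \<le> t\<^sup>2" by simp
  ultimately show ?thesis
    using assms unfolding abs_le_iff by linarith
qed

text \<open>
  Convexity of \<open>t ln t\<close> on \<open>[0, \<infinity>)\<close>, where the convention
  \<open>ln 0 = 0\<close> gives the right value at \<open>0\<close>. It is proved from the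
  tangents at \<open>p\<close>.
\<close>

lemma mult_ln_convex:
  fixes r u e :: real
  assumes "0 < r" "0 \<le> u" "0 < e" "e < 1"
  defines "p \<equiv> (1 - e) * r + e * u"
  shows "p * ln p \<le> (1 - e) * (r * ln r) + e * (u * ln u)"
proof -
  have p: "0 < p" unfolding p_def using assms by (intro add_pos_nonneg) auto
  have tangent: "t * ln p \<le> t * ln t + p - t" if "0 \<le> t" for t
  proof (cases "t = 0")
    case False
    with that have "t * ln p \<le> t * (ln t + p / t - 1)"
      using p by (intro mult_left_mono ln_le_ln_plus_ratio) auto
    also have "\<dots> = t * ln t + p - t" using False by (simp add: algebra_simps)
    finally show ?thesis .
  qed (use p in simp)
  have "p * ln p = (1 - e) * (r * ln p) + e * (u * ln p)"
    by (simp add: p_def algebra_simps)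
  also have "\<dots> \<le> (1 - e) * (r * ln r + p - r) + e * (u * ln u + p - u)"
    using assms by (intro add_mono mult_left_mono tangent) auto
  also have "\<dots> = (1 - e) * (r * ln r) + e * (u * ln u)"
    by (simp add: p_def algebra_simps)
  finally show ?thesis .
qed

text \<open>
  A measure \<open>h \<cdot> N\<close> can have a finite value although its reward and its
  entropy are both infinite; the problem is then to come close to this value with finite
  entropy. Capping \<open>h\<close> at \<open>(n + 1) / (1 + \<bar>g\<bar>)\<close> makes both
  integrands bounded, and since capping does not decrease \<open>g - k ln h\<close> at any
  point, monotone convergence of the positive part recovers the value in the limit. Capping may
  however lower the mean. A small multiple of the uniform distribution on an interval to the
  right of the mean is therefore mixed in, which raises the mean by a fixed amount; by convexity
  of \<open>t ln t\<close> the value suffers only in proportion to the weight of the mixture.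
\<close>

lemma bounded_density_approximation:
  fixes N :: "real measure" and h g :: "real \<Rightarrow> real"
  assumes N: "prob_space N" and sN: "sets N = sets borel"
    and h: "positive_density N h" and xh: "integrable N (\<lambda>x. x * h x)"
    and g: "mono g" and k: "0 < k"
    and U: "0 < measure N {b..b + 1}" and b: "(\<integral>x. x * h x \<partial>N) < b"
    and y: "ereal y < ext_integral (density N (\<lambda>x. ennreal (h x))) (\<lambda>x. ereal (g x - k * ln (h x)))"
  obtains p where "positive_density N p" "integrable N (\<lambda>x. x * p x)"
    "(\<integral>x. x * h x \<partial>N) \<le> (\<integral>x. x * p x \<partial>N)"
    "integrable N (\<lambda>x. p x * ln (p x))" "integrable N (\<lambda>x. p x * g x)"
    "y \<le> (\<integral>x. p x * (g x - k * ln (p x)) \<partial>N)"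
proof -
  interpret N: prob_space N by fact
  note [measurable_cong] = sN
  note [measurable] = borel_measurable_mono[OF g]
  have [measurable]: "h \<in> borel_measurable borel"
    using positive_densityD(1)[OF h] by (simp add: measurable_cong_sets[OF sN refl])
  have hpos: "0 < h x" and hint: "integrable N h" and h1: "(\<integral>x. h x \<partial>N) = 1" for x
    using positive_densityD[OF h] by auto
  define m where "m = (\<integral>x. x * h x \<partial>N)"
  define \<psi> where "\<psi> x = g x - k * ln (h x)" for x
  have [measurable]: "\<psi> \<in> borel_measurable borel" unfolding \<psi>_def by measurable

  define hn where "hn n x = min (h x) (real (Suc n) / (1 + \<bar>g x\<bar>))" for n x
  have [measurable]: "hn n \<in> borel_measurable borel" for n unfolding hn_def by measurable
  have hn_pos: "0 < hn n x" and hn_le: "hn n x \<le> h x" for n x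
    using hpos by (auto simp: hn_def)
  have hn_nn[simp]: "0 \<le> hn n x" and h_nn[simp]: "0 \<le> h x" for n x
    using hn_pos[of n x] hpos[of x] by auto
  have hn_g: "hn n x * (1 + \<bar>g x\<bar>) \<le> real (Suc n)" for n x
    by (simp add: hn_def flip: pos_le_divide_eq)
  have hn_bdd: "hn n x \<le> real (Suc n)" for n x
    by (rule order_trans[OF _ hn_g[of n x]]) (use hn_pos[of n x] in \<open>simp add: distrib_left\<close>)
  have hng_bdd: "\<bar>hn n x * g x\<bar> \<le> real (Suc n)" for n x
    using hn_g[of n x] hn_pos[of n x] by (simp add: abs_mult distrib_left)
  have hn_incseq: "incseq (\<lambda>n. hn n x)" for x
    unfolding hn_def incseq_def by (intro allI impI min.mono divide_right_mono) auto
  have hn_lim: "(\<lambda>n. hn n x) \<longlonglongrightarrow> h x" for x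
  proof (rule tendsto_eventually)
    obtain n0 where "h x * (1 + \<bar>g x\<bar>) \<le> real n0" using real_arch_simple by blast
    then have "h x \<le> real (Suc n) / (1 + \<bar>g x\<bar>)" if "n0 \<le> n" for n
      using that by (simp add: pos_le_divide_eq)
    then show "\<forall>\<^sub>F n in sequentially. hn n x = h x"
      unfolding hn_def by (intro eventually_sequentiallyI[of n0]) auto
  qed
  have hn_int: "integrable N (hn n)" for n
    using hn_bdd hn_pos by (intro N.integrable_const_bound[of _ "real (Suc n)"] AE_I2) (auto simp: abs_of_pos)
  have hng_int: "integrable N (\<lambda>x. hn n x * g x)" for n
    using hng_bdd by (intro N.integrable_const_bound[of _ "real (Suc n)"]) auto
  have hnln_int: "integrable N (\<lambda>x. hn n x * ln (hn n x))" for n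
  proof (rule N.integrable_const_bound[of _ "1 + (real (Suc n))\<^sup>2"])
    show "AE x in N. norm (hn n x * ln (hn n x)) \<le> 1 + (real (Suc n))\<^sup>2"
    proof (rule AE_I2)
      fix x
      have "(hn n x)\<^sup>2 \<le> (real (Suc n))\<^sup>2"
        by (intro power_mono hn_bdd less_imp_le[OF hn_pos])
      then show "norm (hn n x * ln (hn n x)) \<le> 1 + (real (Suc n))\<^sup>2"
        using abs_mult_ln_le[OF hn_pos, of n x] unfolding real_norm_def by linarith
    qed
  qed measurable
  have xhn_int: "integrable N (\<lambda>x. x * hn n x)" for n
    by (rule Bochner_Integration.integrable_bound[OF xh])
       (auto simp: abs_mult hn_le hn_pos hpos less_imp_le intro!: mult_left_mono)

  define Z where "Z n = (\<integral>x. hn n x \<partial>N)" for n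
  have Z_pos: "0 < Z n" for n
  proof -
    have "Z n \<noteq> 0"
    proof
      assume "Z n = 0"
      then have "AE x in N. hn n x = 0"
        unfolding Z_def using hn_int by (subst (asm) integral_nonneg_eq_0_iff_AE) auto
      then have "AE x in N. False" by eventually_elim (use hn_pos in \<open>auto simp: less_le\<close>)
      then show False by simp
    qed
    moreover have "0 \<le> Z n" unfolding Z_def by (intro Bochner_Integration.integral_nonneg) auto
    ultimately show ?thesis by simp
  qed
  have Z_lim: "Z \<longlonglongrightarrow> 1"
  proof -
    have "(\<lambda>n. \<integral>x. hn n x \<partial>N) \<longlonglongrightarrow> (\<integral>x. h x \<partial>N)"
      using hint hn_lim hn_le hn_pos by (intro integral_dominated_convergence[where w = h]) (auto simp: less_imp_le)
    then show ?thesis by (simp add: Z_def[abs_def] h1)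
  qed
  have M_lim: "(\<lambda>n. \<integral>x. x * hn n x \<partial>N) \<longlonglongrightarrow> m"
    unfolding m_def
  proof (rule integral_dominated_convergence[where w = "\<lambda>x. \<bar>x * h x\<bar>"])
    show "integrable N (\<lambda>x. \<bar>x * h x\<bar>)" using xh by (rule integrable_abs)
    show "AE x in N. (\<lambda>n. x * hn n x) \<longlonglongrightarrow> x * h x"
      by (intro AE_I2 tendsto_intros hn_lim)
    show "AE x in N. norm (x * hn n x) \<le> \<bar>x * h x\<bar>" for n
      by (intro AE_I2) (auto simp: abs_mult hn_le intro!: mult_left_mono)
  qed measurable

  obtain y' where y': "y < y'"
    and Jy': "ereal y' < ext_integral (density N (\<lambda>x. ennreal (h x))) (\<lambda>x. ereal (\<psi> x))"
    using ereal_dense2[OF y] unfolding \<psi>_def by auto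
  define G where "G n = (\<integral>x. hn n x * (g x - k * ln (hn n x)) \<partial>N)" for n
  have G_int: "integrable N (\<lambda>x. hn n x * (g x - k * ln (hn n x)))" for n
    using hng_int[of n] hnln_int[of n] by (simp add: right_diff_distrib mult.left_commute[of _ k])
  \<comment> \<open>The integrand of \<open>G n\<close> is at least \<open>hn n\<close> times the positive
    part of \<open>\<psi>\<close> minus \<open>h\<close> times its negative part, and only the
    first of these two depends on \<open>n\<close>.\<close>
  have G_ev: "\<forall>\<^sub>F n in sequentially. y' \<le> G n"
  proof -
    have split: "(\<integral>\<^sup>+ x. ennreal (f x) \<partial>density N (\<lambda>x. ennreal (h x))) = (\<integral>\<^sup>+ x. ennreal (h x * max 0 (f x)) \<partial>N)"
      if [measurable]: "f \<in> borel_measurable borel" for f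
    proof -
      have "(\<integral>\<^sup>+ x. ennreal (f x) \<partial>density N (\<lambda>x. ennreal (h x))) = (\<integral>\<^sup>+ x. ennreal (h x) * ennreal (f x) \<partial>N)"
        by (rule nn_integral_density) measurable
      also have "\<dots> = (\<integral>\<^sup>+ x. ennreal (h x * max 0 (f x)) \<partial>N)"
        using hpos by (intro nn_integral_cong) (auto simp: ennreal_mult' less_imp_le max_def ennreal_neg)
      finally show ?thesis .
    qed
    define Em where "Em = (\<integral>\<^sup>+ x. ennreal (h x * max 0 (- \<psi> x)) \<partial>N)"
    define Ep where "Ep = (\<integral>\<^sup>+ x. ennreal (h x * max 0 (\<psi> x)) \<partial>N)"
    have J: "ereal y' < (if Em = \<infinity> then - \<infinity> else enn2ereal Ep - enn2ereal Em)"
      using Jy' split[of \<psi>] split[of "\<lambda>x. - \<psi> x"]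
      by (simp only: ext_integral_real Em_def Ep_def borel_measurable_uminus \<open>\<psi> \<in> borel_measurable borel\<close>)
    then have Em: "Em \<noteq> \<infinity>" by auto
    define em where "em = enn2real Em"
    have Em_em: "Em = ennreal em" "0 \<le> em" using Em by (auto simp: em_def less_top)
    have neg: "has_bochner_integral N (\<lambda>x. h x * max 0 (- \<psi> x)) em"
      using Em_em hpos by (intro has_bochner_integral_nn_integral) (auto simp: Em_def less_imp_le)
    have "ereal (y' + em) < enn2ereal Ep"
      using J Em_em by (cases Ep) (auto simp: enn2ereal_ennreal)
    then have "ennreal (y' + em) < Ep" if "0 \<le> y' + em"
      using that by (cases Ep) (auto simp: enn2ereal_ennreal ennreal_less_iff)
    moreover have "(\<lambda>n. \<integral>\<^sup>+ x. ennreal (hn n x * max 0 (\<psi> x)) \<partial>N) \<longlonglongrightarrow> Ep"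
      unfolding Ep_def
    proof (rule nn_integral_LIMSEQ)
      show "incseq (\<lambda>n x. ennreal (hn n x * max 0 (\<psi> x)))"
        using hn_incseq by (auto simp: incseq_def le_fun_def intro!: ennreal_leI mult_right_mono)
      show "(\<lambda>n. ennreal (hn n x * max 0 (\<psi> x))) \<longlonglongrightarrow> ennreal (h x * max 0 (\<psi> x))" for x
        by (intro tendsto_ennrealI tendsto_mult hn_lim tendsto_const)
    qed measurable
    ultimately have "\<forall>\<^sub>F n in sequentially.
        0 \<le> y' + em \<longrightarrow> ennreal (y' + em) < (\<integral>\<^sup>+ x. ennreal (hn n x * max 0 (\<psi> x)) \<partial>N)"
      by (cases "0 \<le> y' + em") (auto dest: order_tendstoD(1))
    then show ?thesis
    proof eventually_elim
      case (elim n)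
      have \<psi>_le: "\<psi> x \<le> g x - k * ln (hn n x)" for x
        using k hn_le[of n x] hn_pos[of n x] by (simp add: \<psi>_def)
      have pos_int: "integrable N (\<lambda>x. hn n x * max 0 (\<psi> x))"
      proof (rule Bochner_Integration.integrable_bound[OF G_int[of n]])
        have "max 0 (\<psi> x) \<le> \<bar>g x - k * ln (hn n x)\<bar>" for x using \<psi>_le[of x] by auto
        then show "AE x in N. norm (hn n x * max 0 (\<psi> x)) \<le> norm (hn n x * (g x - k * ln (hn n x)))"
          using hn_pos by (intro AE_I2) (auto simp: abs_mult less_imp_le intro!: mult_left_mono)
      qed measurable
      have "(\<integral>\<^sup>+ x. ennreal (hn n x * max 0 (\<psi> x)) \<partial>N) = ennreal (\<integral>x. hn n x * max 0 (\<psi> x) \<partial>N)"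
        using hn_pos by (intro nn_integral_eq_integral pos_int) (auto simp: less_imp_le)
      with elim have "y' + em \<le> (\<integral>x. hn n x * max 0 (\<psi> x) \<partial>N)"
        by (cases "0 \<le> y' + em")
           (auto simp: ennreal_less_iff intro: order_trans[OF _ Bochner_Integration.integral_nonneg] hn_pos less_imp_le)
      moreover have "(\<integral>x. hn n x * max 0 (\<psi> x) - h x * max 0 (- \<psi> x) \<partial>N) \<le> G n"
        unfolding G_def
      proof (rule integral_mono)
        fix x
        have "hn n x * max 0 (\<psi> x) - h x * max 0 (- \<psi> x) \<le> hn n x * max 0 (\<psi> x) - hn n x * max 0 (- \<psi> x)"
          using hn_le[of n x] by (intro diff_left_mono mult_right_mono) auto
        also have "\<dots> = hn n x * \<psi> x" by (auto simp: max_def)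
        also have "\<dots> \<le> hn n x * (g x - k * ln (hn n x))"
          by (intro mult_left_mono \<psi>_le less_imp_le[OF hn_pos])
        finally show "hn n x * max 0 (\<psi> x) - h x * max 0 (- \<psi> x) \<le> hn n x * (g x - k * ln (hn n x))" .
      qed (use pos_int neg G_int in \<open>auto simp: has_bochner_integral_iff\<close>)
      moreover have "(\<integral>x. hn n x * max 0 (\<psi> x) - h x * max 0 (- \<psi> x) \<partial>N) = (\<integral>x. hn n x * max 0 (\<psi> x) \<partial>N) - em"
        using pos_int neg by (simp add: has_bochner_integral_iff)
      ultimately show "y' \<le> G n" by simp
    qed
  qed

  \<comment> \<open>The added mass sits on a bounded interval, where the monotone function \<open>g\<close> is
    bounded; a Gaussian, say, could have an infinitely negative reward.\<close>
  define D where "D = measure N {b..b + 1}"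
  define u where "u x = indicator {b..b + 1} x / D" for x
  have [measurable]: "u \<in> borel_measurable borel" unfolding u_def by measurable
  have D: "0 < D" using U by (simp add: D_def)
  have u_nonneg: "0 \<le> u x" for x using D by (simp add: u_def)
  have u_le: "u x \<le> 1 / D" for x using D by (auto simp: u_def indicator_def)
  have u_int: "integrable N u"
    using u_le u_nonneg by (intro N.integrable_const_bound[of _ "1 / D"]) auto
  have u1: "(\<integral>x. u x \<partial>N) = 1"
    using D by (simp add: u_def D_def sN)
  have uf_int: "integrable N (\<lambda>x. u x * f x)"
    if [measurable]: "f \<in> borel_measurable borel" and "\<And>x. b \<le> x \<Longrightarrow> x \<le> b + 1 \<Longrightarrow> \<bar>f x\<bar> \<le> K" for f K
  proof (rule N.integrable_const_bound[of _ "K / D"])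
    have "0 \<le> K" using that(2)[of b] by auto
    then show "AE x in N. norm (u x * f x) \<le> K / D"
      using that(2) D by (intro AE_I2) (auto simp: u_def indicator_def divide_right_mono)
  qed measurable
  have ug_int: "integrable N (\<lambda>x. u x * g x)"
  proof (rule uf_int[of _ "max \<bar>g b\<bar> \<bar>g (b + 1)\<bar>"])
    fix x assume "b \<le> x" "x \<le> b + 1"
    then have "g b \<le> g x" "g x \<le> g (b + 1)" using g by (auto simp: mono_def)
    then show "\<bar>g x\<bar> \<le> max \<bar>g b\<bar> \<bar>g (b + 1)\<bar>" by auto
  qed measurable
  have uln_int: "integrable N (\<lambda>x. u x * ln (u x))"
    by (rule uf_int[of _ "\<bar>ln (1 / D)\<bar>"]) (auto simp: u_def)
  have xu_int: "integrable N (\<lambda>x. u x * x)"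
    by (rule uf_int[of _ "\<bar>b\<bar> + 1"]) auto
  have xu: "b \<le> (\<integral>x. u x * x \<partial>N)"
  proof -
    have "b = (\<integral>x. u x * b \<partial>N)" using u1 by simp
    also have "\<dots> \<le> (\<integral>x. u x * x \<partial>N)"
    proof (rule integral_mono)
      show "u x * b \<le> u x * x" for x
        using D by (auto simp: u_def indicator_def divide_right_mono)
    qed (use u_int xu_int in auto)
    finally show ?thesis .
  qed
  define C where "C = (\<integral>x. u x * g x - k * (u x * ln (u x)) \<partial>N)"

  have "((\<lambda>e. (1 - e) * y' + e * C) \<longlongrightarrow> (1 - 0) * y' + 0 * C) (at_right 0)"
    by (intro tendsto_intros)
  then have "\<forall>\<^sub>F e in at_right 0. y < (1 - e) * y' + e * C"
    using y' by (intro order_tendstoD(1)) auto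
  moreover have "\<forall>\<^sub>F e in at_right (0::real). e \<in> {0<..<1}"
    by (rule eventually_at_right_real) simp
  ultimately have "\<forall>\<^sub>F e in at_right 0. y < (1 - e) * y' + e * C \<and> e \<in> {0<..<1}"
    by eventually_elim auto
  then obtain e where e: "y < (1 - e) * y' + e * C" "0 < e" "e < 1"
    using eventually_happens[of _ "at_right (0::real)"] by (auto simp: trivial_limit_at_right_real)

  have "(\<lambda>n. (1 - e) * (y' / Z n + k * ln (Z n)) + e * C) \<longlonglongrightarrow> (1 - e) * (y' / 1 + k * ln 1) + e * C"
    by (intro tendsto_intros Z_lim) auto
  then have ev1: "\<forall>\<^sub>F n in sequentially. y < (1 - e) * (y' / Z n + k * ln (Z n)) + e * C"
    using e(1) by (intro order_tendstoD(1)) auto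
  have "(\<lambda>n. (1 - e) * ((\<integral>x. x * hn n x \<partial>N) / Z n) + e * b) \<longlonglongrightarrow> (1 - e) * (m / 1) + e * b"
    by (intro tendsto_intros Z_lim M_lim) auto
  moreover have "m < (1 - e) * (m / 1) + e * b"
    using b e(2) mult_strict_left_mono[of m b e] by (simp add: m_def algebra_simps)
  ultimately have ev2: "\<forall>\<^sub>F n in sequentially. m < (1 - e) * ((\<integral>x. x * hn n x \<partial>N) / Z n) + e * b"
    by (rule order_tendstoD(1))
  from eventually_conj[OF G_ev eventually_conj[OF ev1 ev2]]
  obtain n where n: "y' \<le> G n" "y < (1 - e) * (y' / Z n + k * ln (Z n)) + e * C"
    "m < (1 - e) * ((\<integral>x. x * hn n x \<partial>N) / Z n) + e * b"
    by (auto simp: eventually_sequentially)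

  define r where "r x = hn n x / Z n" for x
  define p where "p x = (1 - e) * r x + e * u x" for x
  have [measurable]: "r \<in> borel_measurable borel" "p \<in> borel_measurable borel"
    unfolding p_def r_def by measurable
  have r_pos: "0 < r x" for x using hn_pos Z_pos by (simp add: r_def)
  have p_pos: "0 < p x" for x
    unfolding p_def using e r_pos[of x] u_nonneg[of x] by (intro add_pos_nonneg) auto
  have r_int: "integrable N r" "(\<integral>x. r x \<partial>N) = 1"
    using hn_int[of n] Z_pos[of n] by (auto simp: r_def[abs_def] Z_def)
  have rg_int: "integrable N (\<lambda>x. r x * g x)"
    using hng_int[of n] by (simp add: r_def)
  have rln: "r x * ln (r x) = hn n x * ln (hn n x) / Z n - hn n x * (ln (Z n) / Z n)" for x
    using hn_pos[of n x] Z_pos[of n] by (simp add: r_def ln_div field_simps)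
  have rln_int: "integrable N (\<lambda>x. r x * ln (r x))"
    unfolding rln using hnln_int[of n] hn_int[of n] by auto
  have rx_int: "integrable N (\<lambda>x. x * r x)"
    using xhn_int[of n] by (simp add: r_def)
  have p_dens: "positive_density N p"
    using p_pos r_int u_int u1 by (simp add: positive_density_def p_def[abs_def])
  have pg_int: "integrable N (\<lambda>x. p x * g x)"
    unfolding p_def distrib_right mult.assoc using rg_int ug_int by auto
  have px: "x * p x = (1 - e) * (x * r x) + e * (u x * x)" for x
    by (simp add: p_def algebra_simps)
  have px_int: "integrable N (\<lambda>x. x * p x)"
    unfolding px using rx_int xu_int by auto
  have pln_int: "integrable N (\<lambda>x. p x * ln (p x))"
  proof (rule N.integrable_const_bound[of _ "1 + (real (Suc n) / Z n + 1 / D)\<^sup>2"])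
    show "AE x in N. norm (p x * ln (p x)) \<le> 1 + (real (Suc n) / Z n + 1 / D)\<^sup>2"
    proof (rule AE_I2)
      fix x
      have "r x \<le> real (Suc n) / Z n"
        unfolding r_def by (intro divide_right_mono hn_bdd less_imp_le[OF Z_pos])
      moreover have "(1 - e) * r x \<le> r x" "e * u x \<le> u x"
        using e r_pos[of x] u_nonneg[of x] by (auto simp: mult_left_le_one_le less_imp_le)
      ultimately have "p x \<le> real (Suc n) / Z n + 1 / D"
        using u_le[of x] unfolding p_def by linarith
      then have "(p x)\<^sup>2 \<le> (real (Suc n) / Z n + 1 / D)\<^sup>2"
        using p_pos[of x] by (intro power_mono) auto
      then show "norm (p x * ln (p x)) \<le> 1 + (real (Suc n) / Z n + 1 / D)\<^sup>2"
        using abs_mult_ln_le[OF p_pos[of x]] unfolding real_norm_def by linarith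
    qed
  qed measurable
  have "m < (1 - e) * (\<integral>x. x * r x \<partial>N) + e * b"
    using n(3) by (simp add: r_def)
  also have "\<dots> \<le> (1 - e) * (\<integral>x. x * r x \<partial>N) + e * (\<integral>x. u x * x \<partial>N)"
    using xu e by simp
  also have "\<dots> = (\<integral>x. x * p x \<partial>N)"
    unfolding px using rx_int xu_int by simp
  finally have mean: "m \<le> (\<integral>x. x * p x \<partial>N)" by simp

  have rG: "(\<integral>x. r x * g x - k * (r x * ln (r x)) \<partial>N) = G n / Z n + k * ln (Z n)"
  proof -
    have "(\<integral>x. r x * g x - k * (r x * ln (r x)) \<partial>N) =
      (\<integral>x. hn n x * (g x - k * ln (hn n x)) / Z n + hn n x * (k * ln (Z n) / Z n) \<partial>N)"
      by (intro Bochner_Integration.integral_cong refl) (simp add: rln, simp add: r_def algebra_simps diff_divide_distrib)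
    also have "\<dots> = G n / Z n + Z n * (k * ln (Z n) / Z n)"
      using G_int[of n] hn_int[of n] by (simp add: G_def Z_def)
    finally show ?thesis using Z_pos[of n] by simp
  qed
  have "y \<le> (1 - e) * (y' / Z n + k * ln (Z n)) + e * C" using n(2) by simp
  also have "\<dots> \<le> (1 - e) * (G n / Z n + k * ln (Z n)) + e * C"
    using n(1) Z_pos[of n] e by (intro add_right_mono mult_left_mono) (auto simp: divide_right_mono)
  also have "\<dots> = (1 - e) * (\<integral>x. r x * g x - k * (r x * ln (r x)) \<partial>N) + e * C"
    by (simp add: rG)
  also have "\<dots> = (\<integral>x. (1 - e) * (r x * g x - k * (r x * ln (r x))) + e * (u x * g x - k * (u x * ln (u x))) \<partial>N)"
    unfolding C_def using rg_int rln_int ug_int uln_int by simp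
  also have "\<dots> \<le> (\<integral>x. p x * (g x - k * ln (p x)) \<partial>N)"
  proof (rule integral_mono)
    show "integrable N (\<lambda>x. p x * (g x - k * ln (p x)))"
      using pg_int pln_int by (simp add: right_diff_distrib mult.left_commute[of _ k])
    fix x
    have "k * (p x * ln (p x)) \<le> k * ((1 - e) * (r x * ln (r x)) + e * (u x * ln (u x)))"
      unfolding p_def using k e r_pos u_nonneg by (intro mult_left_mono mult_ln_convex) auto
    then show "(1 - e) * (r x * g x - k * (r x * ln (r x))) + e * (u x * g x - k * (u x * ln (u x)))
        \<le> p x * (g x - k * ln (p x))"
      by (simp add: p_def algebra_simps)
  qed (use rg_int rln_int ug_int uln_int in auto)
  finally show ?thesis
    using that p_dens px_int mean pln_int pg_int by (simp add: m_def)
qed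

section \<open>Every terminal value is approached by efforts of finite cost\<close>

text \<open>
  The approximating density has a mean of at least \<open>m\<close>, not exactly
  \<open>m\<close>. This suffices because the reward increases with the mean, so that replacing
  \<open>m\<close> by the larger mean of the approximation does not decrease welfare.
\<close>

lemma terminal_value_le_welfare:
  fixes N :: "real measure"
  assumes P: "prob_space P" and X[measurable]: "(\<lambda>w. w T) \<in> borel_measurable P"
    and N: "N = distr P borel (\<lambda>w. w T)" and U: "\<And>b. 0 < measure N {b..b + 1}"
    and R: "\<And>x r m. 0 \<le> r \<Longrightarrow> r \<le> 1 \<Longrightarrow> R x r m = ereal (\<rho> x m)"
    and \<rho>x: "\<And>m. mono (\<lambda>x. \<rho> x m)" and \<rho>m: "\<And>x. mono (\<rho> x)"
    and k: "0 < c" "0 < \<sigma>"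
    and \<mu>: "\<mu> \<in> equivalent_probs_mean N m"
  shows "ext_integral \<mu> (\<lambda>x. ereal (\<rho> x m - 2 * c * \<sigma>\<^sup>2 * log_density N \<mu> x)) \<le>
    centralized_welfare T \<sigma> c R P"
proof (rule ccontr)
  let ?k = "2 * c * \<sigma>\<^sup>2"
  interpret P: prob_space P by fact
  have Np: "prob_space N" unfolding N by (rule P.prob_space_distr) fact
  have sN: "sets N = sets borel" by (simp add: N)
  note [measurable_cong] = sN
  have [measurable]: "(\<lambda>x. \<rho> x m) \<in> borel_measurable borel" for m
    by (rule borel_measurable_mono[OF \<rho>x])
  obtain h where \<mu>h: "\<mu> = density N (\<lambda>x. ennreal (h x))" and h: "positive_density N h"
    using \<mu> equivalent_probs_eq[OF Np] by (auto simp: equivalent_probs_mean_def)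
  have [measurable]: "h \<in> borel_measurable borel"
    using positive_densityD(1)[OF h] by (simp add: measurable_cong_sets[OF sN refl])
  have id_N: "(\<lambda>x. x) \<in> borel_measurable N" by (rule measurable_ident_sets[OF sN])
  have xh: "integrable N (\<lambda>x. x * h x)" "(\<integral>x. x * h x \<partial>N) = m"
    using \<mu> positive_density_integral[OF h id_N]
    by (simp_all add: equivalent_probs_mean_def \<mu>h mult.commute[of _ "h _"])
  assume "\<not> ?thesis"
  then obtain y where y: "centralized_welfare T \<sigma> c R P < ereal y"
    "ereal y < ext_integral \<mu> (\<lambda>x. ereal (\<rho> x m - ?k * log_density N \<mu> x))"
    using ereal_dense2[of "centralized_welfare T \<sigma> c R P"] by (auto simp: not_le)
  have "ext_integral \<mu> (\<lambda>x. ereal (\<rho> x m - ?k * log_density N \<mu> x)) =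
    ext_integral \<mu> (\<lambda>x. ereal (\<rho> x m - ?k * ln (h x)))"
    by (rule ext_integral_cong_AE,
        rule eventually_mono[OF log_density_positive_density[OF Np h, folded \<mu>h]]) simp
  with y(2) have yJ: "ereal y < ext_integral (density N (\<lambda>x. ennreal (h x))) (\<lambda>x. ereal (\<rho> x m - ?k * ln (h x)))"
    by (simp add: \<mu>h)
  have kpos: "0 < ?k" using k by simp
  obtain p where p: "positive_density N p" "integrable N (\<lambda>x. x * p x)"
    and mean: "m \<le> (\<integral>x. x * p x \<partial>N)"
    and pln: "integrable N (\<lambda>x. p x * ln (p x))" and pg: "integrable N (\<lambda>x. p x * \<rho> x m)"
    and val: "y \<le> (\<integral>x. p x * (\<rho> x m - ?k * ln (p x)) \<partial>N)"
    using bounded_density_approximation[OF Np sN h xh(1) \<rho>x kpos U[of "m + 1"] _ yJ] xh(2) by auto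
  have [measurable]: "p \<in> borel_measurable borel"
    using positive_densityD(1)[OF p(1)] by (simp add: measurable_cong_sets[OF sN refl])
  have "(\<lambda>x. ln (p x)) \<in> borel_measurable borel"
    "(\<lambda>x. \<rho> x m - ?k * ln (p x)) \<in> borel_measurable borel" by measurable
  then have lnp: "(\<lambda>x. ln (p x)) \<in> borel_measurable N" and
    gp: "(\<lambda>x. \<rho> x m - ?k * ln (p x)) \<in> borel_measurable N"
    by (simp_all only: measurable_cong_sets[OF sN refl])
  define q where "q w = p (w T)" for w
  define Q where "Q = density P (\<lambda>w. ennreal (q w))"
  have q: "positive_density P q" and push: "distr Q borel (\<lambda>w. w T) = density N (\<lambda>x. ennreal (p x))"
    using positive_density_pullback[OF X, of p] p(1) by (simp_all add: N q_def[abs_def] Q_def)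
  have [measurable]: "(\<lambda>w. w T) \<in> borel_measurable Q" by (simp add: Q_def)
  have "integrable (density N (\<lambda>x. ennreal (p x))) (\<lambda>x. ln (p x))"
    using pln positive_density_integral(1)[OF p(1) lnp] by simp
  then have int: "integrable Q (\<lambda>w. ln (q w))"
    unfolding push[symmetric] by (simp add: integrable_distr_eq q_def)
  have meanQ: "m \<le> (\<integral>w. w T \<partial>Q)"
  proof -
    have "(\<integral>w. w T \<partial>Q) = (\<integral>x. x \<partial>density N (\<lambda>x. ennreal (p x)))"
      unfolding push[symmetric] by (simp add: integral_distr)
    also have "\<dots> = (\<integral>x. x * p x \<partial>N)"
      using positive_density_integral(2)[OF p(1) id_N] by (simp add: mult.commute)
    finally show ?thesis using mean by simp
  qed
  have "ereal y \<le> ereal (\<integral>x. \<rho> x m - ?k * ln (p x) \<partial>density N (\<lambda>x. ennreal (p x)))"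
    using val positive_density_integral(2)[OF p(1) gp] by simp
  also have "\<dots> = ext_integral (density N (\<lambda>x. ennreal (p x))) (\<lambda>x. ereal (\<rho> x m - ?k * ln (p x)))"
  proof (rule ext_integral_eq_integral[symmetric])
    have "integrable N (\<lambda>x. p x * \<rho> x m - ?k * (p x * ln (p x)))"
      using pln pg by auto
    then show "integrable (density N (\<lambda>x. ennreal (p x))) (\<lambda>x. \<rho> x m - ?k * ln (p x))"
      by (subst positive_density_integral(1)[OF p(1) gp])
         (simp add: right_diff_distrib mult.left_commute[of _ ?k])
  qed
  also have "\<dots> = ext_integral Q (\<lambda>w. ereal (\<rho> (w T) m - ?k * ln (q w)))"
    unfolding push[symmetric] q_def by (rule ext_integral_distr) measurable
  also have "\<dots> \<le> ext_integral Q (\<lambda>w. ereal (\<rho> (w T) (\<integral>w. w T \<partial>Q) - ?k * ln (q w)))"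
    using \<rho>m meanQ by (intro ext_integral_mono_AE AE_I2) (auto simp: mono_def)
  also have "\<dots> = welfare T \<sigma> c R P Q"
    using welfare_positive_density[OF P X R _ q, where \<sigma> = \<sigma> and c = c] int by (simp add: Q_def)
  also have "\<dots> \<le> centralized_welfare T \<sigma> c R P"
    unfolding centralized_welfare_def
  proof (rule SUP_upper)
    show "Q \<in> equivalent_probs P"
      using q equivalent_probs_eq[OF P] by (auto simp: Q_def)
  qed
  finally show False using y(1) by simp
qed

section \<open>Gibbs measures\<close>

lemma borel_measurable_gibbs_weight [measurable]:
  assumes [measurable]: "f0 \<in> borel_measurable borel" "g \<in> borel_measurable borel"
  shows "gibbs_weight k f0 g l \<in> borel_measurable borel"
  unfolding gibbs_weight_def[abs_def] by measurable

lemma not_AE_lborel_False: "\<not> (AE x in (lborel :: real measure). False)"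
  by (simp add: eventually_False ae_filter_eq_bot_iff)

lemma gibbs_weight_integral_pos:
  assumes "\<And>x. 0 < f0 x" and int: "integrable lborel (gibbs_weight k f0 g l)"
  shows "0 < (\<integral>x. gibbs_weight k f0 g l x \<partial>lborel)"
proof -
  have pos: "0 < gibbs_weight k f0 g l x" for x
    using assms(1) by (simp add: gibbs_weight_def)
  have "(\<integral>x. gibbs_weight k f0 g l x \<partial>lborel) \<noteq> 0"
  proof
    assume "(\<integral>x. gibbs_weight k f0 g l x \<partial>lborel) = 0"
    then have "AE x in lborel. gibbs_weight k f0 g l x = 0"
      using int pos by (subst (asm) integral_nonneg_eq_0_iff_AE) (auto simp: less_imp_le)
    then have "AE x in (lborel :: real measure). False"
      by (rule eventually_mono) (use pos in \<open>simp add: less_le\<close>)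
    then show False using not_AE_lborel_False by simp
  qed
  moreover have "0 \<le> (\<integral>x. gibbs_weight k f0 g l x \<partial>lborel)"
    using pos by (intro Bochner_Integration.integral_nonneg) (auto simp: less_imp_le)
  ultimately show ?thesis by simp
qed

lemma gibbs_measure_density:
  fixes f0 g :: "real \<Rightarrow> real"
  assumes f0: "f0 \<in> borel_measurable borel" "\<And>x. 0 < f0 x"
    and g[measurable]: "g \<in> borel_measurable borel"
    and int: "integrable lborel (gibbs_weight k f0 g l)"
  defines "N \<equiv> density lborel (\<lambda>x. ennreal (f0 x))"
    and "h \<equiv> (\<lambda>x. exp ((g x - l * x) / k) / (\<integral>x. gibbs_weight k f0 g l x \<partial>lborel))"
  shows "positive_density N h" and "gibbs_measure k f0 g l = density N (\<lambda>x. ennreal (h x))"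
proof -
  note [measurable] = f0(1)
  define Z where "Z = (\<integral>x. gibbs_weight k f0 g l x \<partial>lborel)"
  have Z: "0 < Z" unfolding Z_def by (rule gibbs_weight_integral_pos[OF f0(2) int])
  have [measurable]: "h \<in> borel_measurable borel" unfolding h_def by measurable
  have f0_nn: "0 \<le> f0 x" for x using f0(2)[of x] by simp
  have h: "h x = exp ((g x - l * x) / k) / Z" for x by (simp add: h_def Z_def)
  have w: "f0 x * h x = gibbs_weight k f0 g l x / Z" for x
    by (simp add: h gibbs_weight_def)
  have "integrable N h"
    unfolding N_def using int f0_nn by (subst integrable_density) (simp_all add: w)
  moreover have "(\<integral>x. h x \<partial>N) = 1"
    unfolding N_def using f0_nn Z by (subst integral_density) (simp_all add: w flip: Z_def)
  ultimately show "positive_density N h"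
    using Z by (simp add: positive_density_def h)
  have "density N (\<lambda>x. ennreal (h x)) = density lborel (\<lambda>x. ennreal (f0 x) * ennreal (h x))"
    unfolding N_def by (rule density_density_eq) measurable
  also have "\<dots> = gibbs_measure k f0 g l"
    unfolding gibbs_measure_def Z_def[symmetric]
    by (intro density_cong AE_I2) (auto simp: ennreal_mult'[symmetric] f0_nn w)
  finally show "gibbs_measure k f0 g l = density N (\<lambda>x. ennreal (h x))" by simp
qed

lemma gibbs_measure_in_equivalent_probs_mean:
  fixes f0 g :: "real \<Rightarrow> real"
  assumes f0: "f0 \<in> borel_measurable borel" "\<And>x. 0 < f0 x"
    and g[measurable]: "g \<in> borel_measurable borel"
    and N: "N = density lborel (\<lambda>x. ennreal (f0 x))" "prob_space N"
    and l: "mean_multiplier k f0 g m l"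
  shows "gibbs_measure k f0 g l \<in> equivalent_probs_mean N m"
proof -
  note [measurable] = f0(1)
  have int: "integrable lborel (gibbs_weight k f0 g l)" using l by (simp add: mean_multiplier_def)
  define Z where "Z = (\<integral>x. gibbs_weight k f0 g l x \<partial>lborel)"
  have Z: "0 < Z" unfolding Z_def by (rule gibbs_weight_integral_pos[OF f0(2) int])
  have nn: "0 \<le> gibbs_weight k f0 g l x / Z" for x
    using f0(2)[of x] Z by (simp add: gibbs_weight_def)
  have "integrable (gibbs_measure k f0 g l) (\<lambda>x. x)"
    using l nn unfolding gibbs_measure_def Z_def[symmetric]
    by (subst integrable_density) (simp_all add: mean_multiplier_def mult.commute)
  moreover have "(\<integral>x. x \<partial>gibbs_measure k f0 g l) = m"
    using l nn unfolding gibbs_measure_def Z_def[symmetric]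
    by (subst integral_density) (simp_all add: mean_multiplier_def mult.commute flip: Z_def)
  moreover have "gibbs_measure k f0 g l \<in> equivalent_probs N"
    using gibbs_measure_density[OF f0 g int] N equivalent_probs_eq[OF N(2)] by auto
  ultimately show ?thesis by (simp add: equivalent_probs_mean_def)
qed

text \<open>
  Up to the affine function \<open>l x + k ln Z\<close>, which has the same integral against all
  measures of mean \<open>m\<close>, the integrand is \<open>k ln (h* / h)\<close> with
  \<open>h*\<close> the Gibbs density. By Gibbs' inequality its integral is at most
  \<open>0\<close>, and it vanishes for \<open>h = h*\<close>.
\<close>

lemma gibbs_variational_principle:
  fixes f0 g :: "real \<Rightarrow> real"
  assumes f0: "f0 \<in> borel_measurable borel" "\<And>x. 0 < f0 x"
    and g[measurable]: "g \<in> borel_measurable borel" and k: "0 < k"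
    and N: "N = density lborel (\<lambda>x. ennreal (f0 x))" "prob_space N"
    and l: "mean_multiplier k f0 g m l"
  defines "J \<equiv> (\<lambda>\<mu>. ext_integral \<mu> (\<lambda>x. ereal (g x - k * log_density N \<mu> x)))"
    and "W \<equiv> ereal (l * m + k * ln (\<integral>y. gibbs_weight k f0 g l y \<partial>lborel))"
  shows "\<mu> \<in> equivalent_probs_mean N m \<Longrightarrow> J \<mu> \<le> W"
    and "J (gibbs_measure k f0 g l) = W"
proof -
  have int: "integrable lborel (gibbs_weight k f0 g l)" using l by (simp add: mean_multiplier_def)
  define Z where "Z = (\<integral>x. gibbs_weight k f0 g l x \<partial>lborel)"
  have Z: "0 < Z" unfolding Z_def by (rule gibbs_weight_integral_pos[OF f0(2) int])
  define hs where "hs x = exp ((g x - l * x) / k) / Z" for x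
  have hs: "positive_density N hs" "gibbs_measure k f0 g l = density N (\<lambda>x. ennreal (hs x))"
    using gibbs_measure_density[OF f0 g int] by (simp_all add: N(1) hs_def[abs_def] Z_def)
  have ln_hs: "g x - k * ln (hs x) = l * x + k * ln Z" for x
    using k Z by (simp add: hs_def ln_div field_simps)
  have lin: "integrable \<mu> (\<lambda>x. l * x + k * ln Z)" "(\<integral>x. l * x + k * ln Z \<partial>\<mu>) = l * m + k * ln Z"
    if "\<mu> \<in> equivalent_probs_mean N m" for \<mu>
  proof -
    interpret \<mu>: prob_space \<mu>
      using that by (simp add: equivalent_probs_mean_def equivalent_probs_def)
    have x: "integrable \<mu> (\<lambda>x. x)" "(\<integral>x. x \<partial>\<mu>) = m"
      using that by (auto simp: equivalent_probs_mean_def)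
    then show "integrable \<mu> (\<lambda>x. l * x + k * ln Z)" by simp
    show "(\<integral>x. l * x + k * ln Z \<partial>\<mu>) = l * m + k * ln Z"
      using x by (simp add: \<mu>.prob_space)
  qed
  show "J \<mu> \<le> W" if \<mu>: "\<mu> \<in> equivalent_probs_mean N m"
  proof -
    interpret \<mu>: prob_space \<mu>
      using \<mu> by (simp add: equivalent_probs_mean_def equivalent_probs_def)
    obtain h where \<mu>h: "\<mu> = density N (\<lambda>x. ennreal (h x))" and h: "positive_density N h"
      using \<mu> equivalent_probs_eq[OF N(2)] by (auto simp: equivalent_probs_mean_def)
    have ratio: "integrable \<mu> (\<lambda>x. hs x / h x)" "(\<integral>x. hs x / h x \<partial>\<mu>) = 1"
      unfolding \<mu>h using integral_ratio_density[OF h positive_densityD(3)[OF hs(1)]]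
        positive_densityD(4)[OF hs(1)] by simp_all
    have le: "g x - k * ln (h x) \<le> l * x + k * ln Z + k * (hs x / h x - 1)" for x
    proof -
      have "k * ln (hs x) \<le> k * (ln (h x) + hs x / h x - 1)"
        using k positive_densityD(2)[OF h] positive_densityD(2)[OF hs(1)]
        by (intro mult_left_mono ln_le_ln_plus_ratio) auto
      then show ?thesis using ln_hs[of x] by (simp add: algebra_simps)
    qed
    have "J \<mu> \<le> ext_integral \<mu> (\<lambda>x. ereal (l * x + k * ln Z + k * (hs x / h x - 1)))"
      unfolding J_def
      by (rule ext_integral_mono_AE,
          rule eventually_mono[OF log_density_positive_density[OF N(2) h, folded \<mu>h]]) (simp add: le)
    also have "\<dots> = ereal (\<integral>x. l * x + k * ln Z + k * (hs x / h x - 1) \<partial>\<mu>)"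
      using lin(1)[OF \<mu>] ratio(1) by (intro ext_integral_eq_integral) simp
    also have "(\<integral>x. l * x + k * ln Z + k * (hs x / h x - 1) \<partial>\<mu>) = l * m + k * ln Z"
    proof -
      have "(\<integral>x. (l * x + k * ln Z) + k * (hs x / h x - 1) \<partial>\<mu>) =
        (\<integral>x. l * x + k * ln Z \<partial>\<mu>) + (\<integral>x. k * (hs x / h x - 1) \<partial>\<mu>)"
        using lin(1)[OF \<mu>] ratio(1) by (intro Bochner_Integration.integral_add) auto
      then show ?thesis using lin(2)[OF \<mu>] ratio by (simp add: \<mu>.prob_space)
    qed
    finally show ?thesis by (simp add: W_def Z_def)
  qed
  let ?G = "gibbs_measure k f0 g l"
  have "J ?G = ext_integral ?G (\<lambda>x. ereal (l * x + k * ln Z))"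
    unfolding J_def
    by (rule ext_integral_cong_AE,
        rule eventually_mono[OF log_density_positive_density[OF N(2) hs(1), folded hs(2)]]) (simp add: ln_hs)
  also have "\<dots> = W"
    using lin[OF gibbs_measure_in_equivalent_probs_mean[OF f0 g N l]]
    by (simp add: ext_integral_eq_integral W_def Z_def)
  finally show "J ?G = W" .
qed

section \<open>Existence and uniqueness of the multiplier\<close>

text \<open>
  Increasing the multiplier tilts the Gibbs measure to the left, so its mean strictly decreases.
  For \<open>l' < l\<close> the weights satisfy \<open>w\<^sub>l\<^sub>' = exp (a x)
  w\<^sub>l\<close> with \<open>a > 0\<close>, and if both have mean \<open>m\<close> then the
  nonnegative function \<open>(x - m) (exp (a x) - exp (a m)) w\<^sub>l\<close> has integral
  \<open>0\<close>.
\<close>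

lemma mean_multiplier_unique:
  fixes f0 g :: "real \<Rightarrow> real"
  assumes f0: "\<And>x. 0 < f0 x" and k: "0 < k"
    and l: "mean_multiplier k f0 g m l" and l': "mean_multiplier k f0 g m l'"
  shows "l' = l"
proof -
  let ?w = "gibbs_weight k f0 g"
  have zero: "integrable lborel (\<lambda>x. (x - m) * ?w l x)" "(\<integral>x. (x - m) * ?w l x \<partial>lborel) = 0"
    if l: "mean_multiplier k f0 g m l" for l
  proof -
    have i: "integrable lborel (?w l)" "integrable lborel (\<lambda>x. x * ?w l x)"
      and m: "m = (\<integral>x. x * ?w l x \<partial>lborel) / (\<integral>x. ?w l x \<partial>lborel)"
      using l by (auto simp: mean_multiplier_def)
    have "0 < (\<integral>x. ?w l x \<partial>lborel)" by (rule gibbs_weight_integral_pos[OF f0 i(1)])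
    with m have "(\<integral>x. x * ?w l x \<partial>lborel) = m * (\<integral>x. ?w l x \<partial>lborel)" by (simp add: field_simps)
    then show "integrable lborel (\<lambda>x. (x - m) * ?w l x)" "(\<integral>x. (x - m) * ?w l x \<partial>lborel) = 0"
      using i by (simp_all add: left_diff_distrib)
  qed
  have ne: False if l: "mean_multiplier k f0 g m l" and l': "mean_multiplier k f0 g m l'" and less: "l' < l" for l l'
  proof -
    define a where "a = (l - l') / k"
    have a: "0 < a" using less k by (simp add: a_def)
    have shift: "?w l' x = ?w l x * exp (a * x)" for x
    proof -
      have "(g x - l' * x) / k = (g x - l * x) / k + a * x"
        by (simp add: a_def diff_divide_distrib algebra_simps)
      then show ?thesis by (simp add: gibbs_weight_def exp_add)
    qed
    define F where "F x = (x - m) * ?w l' x - exp (a * m) * ((x - m) * ?w l x)" for x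
    have F: "F x = ?w l x * ((x - m) * (exp (a * x) - exp (a * m)))" for x
      by (simp add: F_def shift algebra_simps)
    have wpos: "0 < ?w l x" for x using f0 by (simp add: gibbs_weight_def)
    have sgn: "0 \<le> (x - m) * (exp (a * x) - exp (a * m))" for x
      using a by (cases "m \<le> x") (auto intro: mult_nonneg_nonneg mult_nonpos_nonpos)
    have "integrable lborel F" "(\<integral>x. F x \<partial>lborel) = 0"
      using zero[OF l] zero[OF l'] by (simp_all add: F_def[abs_def])
    moreover have "AE x in lborel. 0 \<le> F x"
      using wpos sgn by (intro AE_I2) (simp add: F less_imp_le)
    ultimately have "AE x in lborel. F x = 0"
      by (simp add: integral_nonneg_eq_0_iff_AE)
    then have "AE x in lborel. x = m"
    proof eventually_elim
      case (elim x)
      then show ?case using wpos[of x] a by (auto simp: F)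
    qed
    moreover have "AE x in lborel. x \<noteq> m" by (rule AE_lborel_singleton)
    ultimately have "AE x in (lborel :: real measure). False" by eventually_elim simp
    then show False using not_AE_lborel_False by simp
  qed
  show ?thesis
    using ne[OF l l'] ne[OF l' l] by (meson linorder_neqE_linordered_idom)
qed

text \<open>
  The multiplier is a minimiser of \<open>\<Phi> l = \<integral> f0 x exp ((g x - l (x - m)) /
  k)\<close>, whose derivative is \<open>- 1 / k\<close> times the first moment, centred at
  \<open>m\<close>, of its integrand. As a function with values in \<open>[0,
  \<infinity>]\<close>, \<open>\<Phi>\<close> is lower semicontinuous by Fatou's lemma and tends
  to infinity in both directions, so a minimiser exists without any study of the boundary of the
  interval where \<open>\<Phi>\<close> is finite. Openness of that interval puts the minimiser
  in its interior; there the moment exists and vanishes.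
\<close>

lemma mean_multiplier_exists:
  fixes f0 g :: "real \<Rightarrow> real"
  assumes f0: "f0 \<in> borel_measurable borel" "\<And>x. 0 < f0 x"
    and g[measurable]: "g \<in> borel_measurable borel" and k: "0 < k"
  defines "I \<equiv> {l. integrable lborel (gibbs_weight k f0 g l)}"
  assumes ne: "I \<noteq> {}" and "open I"
  shows "\<exists>l. mean_multiplier k f0 g m l"
proof -
  note [measurable] = f0(1)
  define v where "v l x = f0 x * exp ((g x - l * (x - m)) / k)" for l x
  have v_meas[measurable]: "v l \<in> borel_measurable borel" for l unfolding v_def[abs_def] by measurable
  have v_pos: "0 < v l x" and v_nn[simp]: "0 \<le> v l x" for l x
    using f0(2)[of x] by (simp_all add: v_def)
  have v_w: "v l x = exp (l * m / k) * gibbs_weight k f0 g l x" for l x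
  proof -
    have "(g x - l * (x - m)) / k = l * m / k + (g x - l * x) / k"
      using k by (simp add: field_simps)
    then show ?thesis by (simp add: v_def gibbs_weight_def exp_add)
  qed
  have v_int: "integrable lborel (v l) \<longleftrightarrow> l \<in> I" for l
    by (simp add: v_w[abs_def] I_def)
  have v_shift: "v (l + t) x = v l x * exp (- t * (x - m) / k)" for l t x
  proof -
    have "(g x - (l + t) * (x - m)) / k = (g x - l * (x - m)) / k + - t * (x - m) / k"
      using k by (simp add: field_simps)
    then show ?thesis by (simp only: v_def exp_add mult.assoc)
  qed
  define \<Phi> where "\<Phi> l = (\<integral>\<^sup>+ x. ennreal (v l x) \<partial>lborel)" for l
  have \<Phi>_fin: "\<Phi> l < \<infinity> \<longleftrightarrow> l \<in> I" for l
    unfolding v_int[symmetric] \<Phi>_def by (simp add: integrable_iff_bounded)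
  have lsc: "\<Phi> l \<le> liminf (\<lambda>n. \<Phi> (s n))" if "s \<longlonglongrightarrow> l" for s l
  proof -
    have "(\<lambda>n. ennreal (v (s n) x)) \<longlonglongrightarrow> ennreal (v l x)" for x
      unfolding v_def using that k by (intro tendsto_ennrealI tendsto_intros) auto
    then have "ennreal (v l x) = liminf (\<lambda>n. ennreal (v (s n) x))" for x
      by (intro lim_imp_Liminf[symmetric]) auto
    then have "\<Phi> l = (\<integral>\<^sup>+ x. liminf (\<lambda>n. ennreal (v (s n) x)) \<partial>lborel)"
      by (simp add: \<Phi>_def)
    also have "\<dots> \<le> liminf (\<lambda>n. \<Phi> (s n))"
      unfolding \<Phi>_def by (rule nn_integral_liminf) simp
    finally show ?thesis .
  qed

  \<comment> \<open>For every sign of \<open>l\<close> there is a unit interval on which the exponent \<open>-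
    l (x - m)\<close> is at least \<open>\<bar>l\<bar>\<close>; this gives exponential growth
    of \<open>\<Phi>\<close>.\<close>
  define A where "A b = (\<integral>\<^sup>+ x. ennreal (indicator {b..b + 1} x * v 0 x) \<partial>lborel)" for b
  have A_pos: "0 < A b" for b
  proof -
    have "A b \<noteq> 0"
    proof
      assume "A b = 0"
      then have "AE x in lborel. ennreal (indicator {b..b + 1} x * v 0 x) = 0"
        unfolding A_def by (subst (asm) nn_integral_0_iff_AE) auto
      then have "AE x in lborel. x \<notin> {b..b + 1}"
      proof eventually_elim
        case (elim x)
        then show ?case using v_pos[of 0 x] by (auto simp: indicator_def ennreal_eq_0_iff)
      qed
      then have "{b..b + 1} \<in> null_sets lborel" by (simp add: AE_iff_null_sets)
      from null_setsD1[OF this] show False by simp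
    qed
    then show ?thesis by (simp add: zero_less_iff_neq_zero)
  qed
  define C where "C = min (A (m - 2)) (A (m + 1))"
  have C_pos: "0 < C" using A_pos by (simp add: C_def)
  have coercive: "C * ennreal (exp (\<bar>l\<bar> / k)) \<le> \<Phi> l" for l
  proof -
    have *: "A b * ennreal (exp (\<bar>l\<bar> / k)) \<le> \<Phi> l"
      if b: "\<And>x. b \<le> x \<Longrightarrow> x \<le> b + 1 \<Longrightarrow> \<bar>l\<bar> \<le> - l * (x - m)" for b
    proof -
      have "A b * ennreal (exp (\<bar>l\<bar> / k)) =
          (\<integral>\<^sup>+ x. ennreal (indicator {b..b + 1} x * v 0 x) * ennreal (exp (\<bar>l\<bar> / k)) \<partial>lborel)"
        unfolding A_def by (rule nn_integral_multc[symmetric]) simp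
      also have "\<dots> \<le> \<Phi> l"
        unfolding \<Phi>_def
      proof (rule nn_integral_mono)
        fix x
        have "v 0 x * exp (\<bar>l\<bar> / k) \<le> v l x" if "x \<in> {b..b + 1}"
        proof -
          have "\<bar>l\<bar> / k \<le> - l * (x - m) / k"
            using b[of x] that k by (intro divide_right_mono) auto
          then show ?thesis
            using v_shift[of 0 l x] by (simp add: mult_left_mono)
        qed
        then show "ennreal (indicator {b..b + 1} x * v 0 x) * ennreal (exp (\<bar>l\<bar> / k)) \<le> ennreal (v l x)"
          by (auto simp: indicator_def ennreal_mult'[symmetric] intro!: ennreal_leI)
      qed
      finally show ?thesis .
    qed
    show ?thesis
    proof (cases "0 \<le> l")
      case True
      have "C * ennreal (exp (\<bar>l\<bar> / k)) \<le> A (m - 2) * ennreal (exp (\<bar>l\<bar> / k))"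
        by (intro mult_right_mono) (auto simp: C_def)
      also have "\<dots> \<le> \<Phi> l"
      proof (rule *)
        fix x assume "m - 2 \<le> x" "x \<le> m - 2 + 1"
        then show "\<bar>l\<bar> \<le> - l * (x - m)"
          using True mult_left_mono[of 1 "m - x" l] by (simp add: algebra_simps)
      qed
      finally show ?thesis .
    next
      case False
      have "C * ennreal (exp (\<bar>l\<bar> / k)) \<le> A (m + 1) * ennreal (exp (\<bar>l\<bar> / k))"
        by (intro mult_right_mono) (auto simp: C_def)
      also have "\<dots> \<le> \<Phi> l"
      proof (rule *)
        fix x assume "m + 1 \<le> x" "x \<le> m + 1 + 1"
        then show "\<bar>l\<bar> \<le> - l * (x - m)"
          using False mult_left_mono[of 1 "x - m" "- l"] by (simp add: algebra_simps)
      qed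
      finally show ?thesis .
    qed
  qed

  have bounded_sublevel: "\<exists>B. \<forall>l. \<Phi> l \<le> ennreal K \<longrightarrow> \<bar>l\<bar> \<le> B" if K: "0 \<le> K" for K
  proof (cases "C = \<infinity>")
    case True
    have "\<not> \<Phi> l \<le> ennreal K" for l
      using coercive[of l] True by (auto simp: ennreal_top_mult top_unique)
    then show ?thesis by blast
  next
    case False
    then obtain c where c: "C = ennreal c" "0 < c"
      using C_pos by (cases C) (auto simp: less_le)
    have "\<bar>l\<bar> \<le> k * (K / c)" if l: "\<Phi> l \<le> ennreal K" for l
    proof -
      have "ennreal (c * exp (\<bar>l\<bar> / k)) \<le> ennreal K"
        using order_trans[OF coercive l] c by (simp add: ennreal_mult'')
      then have "c * exp (\<bar>l\<bar> / k) \<le> K" using K by (simp add: ennreal_le_iff)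
      moreover have "c * (\<bar>l\<bar> / k) \<le> c * exp (\<bar>l\<bar> / k)"
        using c exp_ge_add_one_self[of "\<bar>l\<bar> / k"] by (intro mult_left_mono) linarith+
      ultimately have "c * (\<bar>l\<bar> / k) \<le> K" by linarith
      then show ?thesis using c k by (simp add: field_simps)
    qed
    then show ?thesis by blast
  qed

  obtain l0 where l0: "\<And>l. \<Phi> l0 \<le> \<Phi> l"
  proof -
    obtain l1 where "\<Phi> l1 < \<infinity>" using ne \<Phi>_fin by blast
    then have inf_fin: "Inf (range \<Phi>) < \<infinity>"
      using Inf_lower[of "\<Phi> l1" "range \<Phi>"] by auto
    then obtain i where i: "Inf (range \<Phi>) = ennreal i" "0 \<le> i"
      by (cases "Inf (range \<Phi>)") auto
    define K where "K = i + 1"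
    have K: "Inf (range \<Phi>) < ennreal K" "0 \<le> K"
      using i by (simp_all add: K_def ennreal_less_iff)
    obtain u where u: "\<And>n. u n \<in> range \<Phi>" "u \<longlonglongrightarrow> Inf (range \<Phi>)"
      using Inf_as_limit[of "range \<Phi>"] by auto
    then have "\<forall>n. \<exists>l. u n = \<Phi> l" by blast
    then obtain s where s: "\<And>n. u n = \<Phi> (s n)" by (auto dest: choice)
    have "\<forall>\<^sub>F n in sequentially. \<Phi> (s n) < ennreal K"
      using order_tendstoD(2)[OF u(2) K(1)] by (simp add: s)
    then obtain n0 where n0: "\<And>n. n0 \<le> n \<Longrightarrow> \<Phi> (s n) < ennreal K"
      by (auto simp: eventually_sequentially)
    obtain B where B: "\<And>l. \<Phi> l \<le> ennreal K \<Longrightarrow> \<bar>l\<bar> \<le> B" using bounded_sublevel[OF K(2)] by blast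
    have "bounded (range (\<lambda>n. s (n + n0)))"
    proof (unfold bounded_iff, intro exI[of _ B] ballI)
      fix y assume "y \<in> range (\<lambda>n. s (n + n0))"
      then obtain n where "y = s (n + n0)" by blast
      then show "norm y \<le> B" using B[OF less_imp_le[OF n0[of "n + n0"]]] by simp
    qed
    then obtain l0 r where r: "strict_mono r" "((\<lambda>n. s (n + n0)) \<circ> r) \<longlonglongrightarrow> l0"
      using bounded_imp_convergent_subsequence by blast
    have "(\<lambda>n. u (r n + n0)) \<longlonglongrightarrow> Inf (range \<Phi>)"
      using LIMSEQ_subseq_LIMSEQ[OF LIMSEQ_ignore_initial_segment[OF u(2), of n0] r(1)]
      by (simp add: comp_def)
    then have "liminf (\<lambda>n. \<Phi> (((\<lambda>n. s (n + n0)) \<circ> r) n)) = Inf (range \<Phi>)"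
      by (intro lim_imp_Liminf) (simp_all add: s)
    with lsc[OF r(2)] have "\<Phi> l0 \<le> Inf (range \<Phi>)" by simp
    then show ?thesis
      by (intro that[of l0]) (rule order_trans[OF _ Inf_lower[OF rangeI]])
  qed
  have l0I: "l0 \<in> I"
  proof -
    obtain l1 where "\<Phi> l1 < \<infinity>" using ne \<Phi>_fin by blast
    with l0[of l1] show ?thesis unfolding \<Phi>_fin[symmetric] by simp
  qed

  obtain e where e: "0 < e" "cball l0 e \<subseteq> I"
    using \<open>open I\<close> l0I open_contains_cball by blast
  define d where "d = e / 2"
  have dI: "l0 + t \<in> I" if "\<bar>t\<bar> \<le> 2 * d" for t
    using e that by (auto simp: d_def dist_real_def)
  have d: "0 < d" using e by (simp add: d_def)
  define b where "b x = \<bar>x - m\<bar> * (v (l0 - d) x + v (l0 + d) x)" for x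
  have exp_abs: "exp (d * \<bar>x - m\<bar> / k) \<le> exp (- d * (x - m) / k) + exp (d * (x - m) / k)" for x
    using exp_abs_le[of "d * (x - m) / k"] d k by (simp add: abs_mult)
  have abs_bound: "\<bar>x - m\<bar> * v l x \<le> k / d * (v (l + d) x + v (l - d) x)" for l x
  proof -
    have "d * \<bar>x - m\<bar> / k \<le> exp (d * \<bar>x - m\<bar> / k)"
      using exp_ge_add_one_self[of "d * \<bar>x - m\<bar> / k"] by linarith
    also have "\<dots> \<le> exp (- d * (x - m) / k) + exp (d * (x - m) / k)"
      by (rule exp_abs)
    finally have "v l x * (d * \<bar>x - m\<bar> / k) \<le> v l x * (exp (- d * (x - m) / k) + exp (d * (x - m) / k))"
      by (rule mult_left_mono) simp
    also have "\<dots> = v (l + d) x + v (l - d) x"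
      using v_shift[of l d x] v_shift[of l "- d" x] by (simp add: distrib_left)
    finally show ?thesis using d k by (simp add: field_simps)
  qed
  have mom_int: "integrable lborel (\<lambda>x. \<bar>x - m\<bar> * v (l0 + t) x)" if "\<bar>t\<bar> \<le> d" for t
  proof (rule Bochner_Integration.integrable_bound)
    have "integrable lborel (v (l0 + t + d))" "integrable lborel (v (l0 + t - d))"
      using dI[of "t + d"] dI[of "t - d"] that by (auto simp: v_int add.assoc add_diff_eq)
    then show "integrable lborel (\<lambda>x. k / d * (v (l0 + t + d) x + v (l0 + t - d) x))" by simp
    show "AE x in lborel. norm (\<bar>x - m\<bar> * v (l0 + t) x) \<le> norm (k / d * (v (l0 + t + d) x + v (l0 + t - d) x))"
      using abs_bound k d by (intro AE_I2) (simp add: abs_mult)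
  qed simp
  have mom_int': "integrable lborel (\<lambda>x. (x - m) * v (l0 + t) x)" if "\<bar>t\<bar> \<le> d" for t
    by (rule Bochner_Integration.integrable_bound[OF mom_int[OF that]]) (auto simp: abs_mult)
  define D where "D t = (\<integral>x. (x - m) * v (l0 + t) x \<partial>lborel)" for t
  \<comment> \<open>The tangent inequality \<open>exp y \<ge> 1 + y\<close> at \<open>l0 + t\<close> and
    minimality of \<open>\<Phi> l0\<close> determine the sign of the moment on each side of
    \<open>l0\<close>.\<close>
  have sign: "t * D t \<le> 0" if t: "\<bar>t\<bar> \<le> d" for t
  proof -
    have i: "integrable lborel (v l0)" "integrable lborel (v (l0 + t))"
      using dI[of t] l0I t d by (auto simp: v_int)
    have "ennreal (\<integral>x. v l0 x \<partial>lborel) \<le> ennreal (\<integral>x. v (l0 + t) x \<partial>lborel)"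
      using l0[of "l0 + t"] i by (simp add: \<Phi>_def nn_integral_eq_integral)
    then have "(\<integral>x. v l0 x \<partial>lborel) \<le> (\<integral>x. v (l0 + t) x \<partial>lborel)"
      by (simp add: ennreal_le_iff)
    moreover have "(\<integral>x. v (l0 + t) x + t / k * ((x - m) * v (l0 + t) x) \<partial>lborel) \<le> (\<integral>x. v l0 x \<partial>lborel)"
    proof (rule integral_mono)
      fix x
      have "v (l0 + t) x * (1 + t * (x - m) / k) \<le> v (l0 + t) x * exp (t * (x - m) / k)"
        by (intro mult_left_mono exp_ge_add_one_self) simp
      also have "\<dots> = v l0 x"
        using v_shift[of "l0 + t" "- t" x] by simp
      finally show "v (l0 + t) x + t / k * ((x - m) * v (l0 + t) x) \<le> v l0 x"
        using k by (simp add: field_simps)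
    qed (use i mom_int'[OF t] in auto)
    ultimately have "t / k * D t \<le> 0"
      using i mom_int'[OF t] by (simp add: D_def)
    then show ?thesis using k by (simp add: divide_le_0_iff zero_le_mult_iff mult_le_0_iff)
  qed
  have D_lim: "(\<lambda>n. D (s n)) \<longlonglongrightarrow> D 0" if s: "s \<longlonglongrightarrow> 0" "\<And>n. \<bar>s n\<bar> \<le> d" for s
    unfolding D_def
  proof (rule integral_dominated_convergence[where w = b])
    show "integrable lborel b"
      using mom_int[of d] mom_int[of "- d"] d by (simp add: b_def[abs_def] distrib_left)
    show "AE x in lborel. (\<lambda>n. (x - m) * v (l0 + s n) x) \<longlonglongrightarrow> (x - m) * v (l0 + 0) x"
      unfolding v_def using s(1) k by (intro AE_I2 tendsto_intros) auto
    show "AE x in lborel. norm ((x - m) * v (l0 + s n) x) \<le> b x" for n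
    proof (rule AE_I2)
      fix x
      have "\<bar>- s n * (x - m) / k\<bar> \<le> d * \<bar>x - m\<bar> / k"
        using s(2)[of n] k by (auto simp: abs_mult intro!: divide_right_mono mult_right_mono)
      then have "exp (- s n * (x - m) / k) \<le> exp (d * \<bar>x - m\<bar> / k)"
        unfolding exp_le_cancel_iff by linarith
      also have "\<dots> \<le> exp (- d * (x - m) / k) + exp (d * (x - m) / k)"
        by (rule exp_abs)
      finally have "v l0 x * exp (- s n * (x - m) / k) \<le> v l0 x * (exp (- d * (x - m) / k) + exp (d * (x - m) / k))"
        by (rule mult_left_mono) simp
      then have "v (l0 + s n) x \<le> v (l0 - d) x + v (l0 + d) x"
        using v_shift[of l0 "s n" x] v_shift[of l0 d x] v_shift[of l0 "- d" x] by (simp add: distrib_left)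
      then show "norm ((x - m) * v (l0 + s n) x) \<le> b x"
        by (simp add: b_def abs_mult mult_left_mono)
    qed
  qed (simp_all add: b_def[abs_def])
  define s where "s n = d / real (Suc n)" for n
  have s_pos: "0 < s n" and s_le: "s n \<le> d" for n
    using d by (auto simp: s_def field_simps)
  have s_lim: "s \<longlonglongrightarrow> 0"
    unfolding s_def[abs_def] using LIMSEQ_Suc[OF lim_const_over_n[of d]] by simp
  have "D 0 \<le> 0"
  proof (rule LIMSEQ_le_const2[OF D_lim[OF s_lim]])
    show "\<bar>s n\<bar> \<le> d" for n using s_pos[of n] s_le[of n] by simp
    have "D (s n) \<le> 0" for n
      using sign[of "s n"] s_pos[of n] s_le[of n] by (simp add: mult_le_0_iff)
    then show "\<exists>n0. \<forall>n\<ge>n0. D (s n) \<le> 0" by blast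
  qed
  moreover have "0 \<le> D 0"
  proof (rule LIMSEQ_le_const[OF D_lim[of "\<lambda>n. - s n"]])
    show "(\<lambda>n. - s n) \<longlonglongrightarrow> 0" using tendsto_minus[OF s_lim] by simp
    show "\<bar>- s n\<bar> \<le> d" for n using s_pos[of n] s_le[of n] by simp
    have "0 \<le> D (- s n)" for n
      using sign[of "- s n"] s_pos[of n] s_le[of n] by (simp add: zero_le_mult_iff)
    then show "\<exists>n0. \<forall>n\<ge>n0. 0 \<le> D (- s n)" by blast
  qed
  ultimately have D0: "D 0 = 0" by simp

  let ?w = "gibbs_weight k f0 g l0"
  have w_int: "integrable lborel ?w" using l0I by (simp add: I_def)
  have xv: "(x - m) * v l0 x = exp (l0 * m / k) * ((x - m) * ?w x)" for x
    by (simp add: v_w)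
  have "integrable lborel (\<lambda>x. (x - m) * v l0 x)" using mom_int'[of 0] d by simp
  then have xw': "integrable lborel (\<lambda>x. (x - m) * ?w x)"
    unfolding xv by simp
  then have "integrable lborel (\<lambda>x. (x - m) * ?w x + m * ?w x)"
    using w_int by auto
  then have xw: "integrable lborel (\<lambda>x. x * ?w x)" by (simp add: algebra_simps)
  have "exp (l0 * m / k) * (\<integral>x. (x - m) * ?w x \<partial>lborel) = 0"
    using D0 by (simp add: D_def xv)
  then have "(\<integral>x. x * ?w x - m * ?w x \<partial>lborel) = 0" by (simp add: left_diff_distrib)
  then have "(\<integral>x. x * ?w x \<partial>lborel) = m * (\<integral>x. ?w x \<partial>lborel)"
    using xw w_int by simp
  moreover have "0 < (\<integral>x. ?w x \<partial>lborel)" by (rule gibbs_weight_integral_pos[OF f0(2) w_int])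
  ultimately have "mean_multiplier k f0 g m l0"
    using w_int xw by (simp add: mean_multiplier_def)
  then show ?thesis ..
qed

section \<open>The optimal centralized welfare\<close>

theorem mainTheorem9:
  fixes T \<sigma> c x0 :: real
    and M :: "'w measure" and B :: "real \<Rightarrow> 'w \<Rightarrow> real"
    and R :: "real \<Rightarrow> real \<Rightarrow> real \<Rightarrow> ereal" and \<rho> :: "real \<Rightarrow> real \<Rightarrow> real"
    and P :: "(real \<Rightarrow> real) measure" and V :: ereal
    and k :: real and f0 :: "real \<Rightarrow> real" and N :: "real measure"
    and J :: "real \<Rightarrow> real measure \<Rightarrow> ereal"
  assumes "T > 0" and "\<sigma> > 0" and "c > 0"
    and "standard_brownian_motion T M B"
    and "reward_function R"
    and "\<And>x r m. 0 \<le> r \<Longrightarrow> r \<le> 1 \<Longrightarrow> R x r m = ereal (\<rho> x m)"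
  defines "P \<equiv> scaled_path_law T \<sigma> x0 M B"
    and "V \<equiv> centralized_welfare T \<sigma> c R P"
    and "k \<equiv> 2 * c * \<sigma>\<^sup>2"
    and "f0 \<equiv> normal_density x0 (\<sigma> * sqrt T)"
    and "N \<equiv> density lborel (\<lambda>x. ennreal (f0 x))"
    and "J \<equiv> (\<lambda>m \<mu>. ext_integral \<mu> (\<lambda>x. ereal (\<rho> x m - k * log_density N \<mu> x)))"
  shows "V = (SUP m. SUP \<mu>\<in>equivalent_probs_mean N m. J m \<mu>) \<and>
    (\<forall>m l. mean_multiplier k f0 (\<lambda>x. \<rho> x m) m l \<longrightarrow>
      (\<forall>l'. mean_multiplier k f0 (\<lambda>x. \<rho> x m) m l' \<longrightarrow> l' = l) \<and>
      gibbs_measure k f0 (\<lambda>x. \<rho> x m) l \<in> equivalent_probs_mean N m \<and>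
      (\<forall>\<mu>\<in>equivalent_probs_mean N m. J m \<mu> \<le> J m (gibbs_measure k f0 (\<lambda>x. \<rho> x m) l))) \<and>
    (\<forall>m. {l. integrable lborel (gibbs_weight k f0 (\<lambda>x. \<rho> x m) l)} \<noteq> {} \<and>
      open {l. integrable lborel (gibbs_weight k f0 (\<lambda>x. \<rho> x m) l)} \<longrightarrow>
      (\<exists>l. mean_multiplier k f0 (\<lambda>x. \<rho> x m) m l)) \<and>
    (\<forall>lam. (\<forall>m. mean_multiplier k f0 (\<lambda>x. \<rho> x m) m (lam m)) \<longrightarrow>
      V = (SUP m. ereal (lam m * m
             + k * ln (\<integral>y. gibbs_weight k f0 (\<lambda>x. \<rho> x m) (lam m) y \<partial>lborel))))"
proof -
  have k: "0 < k" using assms(2,3) by (simp add: k_def)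
  have s: "0 < \<sigma> * sqrt T" using assms(1,2) by simp
  note law = terminal_law[OF assms(1,2,4), of x0, folded P_def]
  have P: "prob_space P" by (rule law(1))
  have X: "(\<lambda>w. w T) \<in> borel_measurable P" by (rule law(2))
  have N: "N = distr P borel (\<lambda>w. w T)" by (simp add: law(3) N_def f0_def)
  have Np: "prob_space N" unfolding N by (rule prob_space.prob_space_distr[OF P X])
  have f0: "f0 \<in> borel_measurable borel" "\<And>x. 0 < f0 x"
    using s by (simp_all add: f0_def normal_density_pos)
  have e: "integrable N (\<lambda>x. exp \<bar>x\<bar>)"
    unfolding N_def f0_def by (rule integrable_exp_abs_normal[OF s])
  have mono: "R x r m \<le> R x' r' m'" if "x \<le> x'" "0 \<le> r" "r \<le> r'" "r' \<le> 1" "m \<le> m'" for x x' r r' m m'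
    using assms(5) that unfolding reward_function_def by blast
  have \<rho>: "\<rho> x m \<le> \<rho> x' m'" if "x \<le> x'" "m \<le> m'" for x x' m m'
    using mono[of x x' 0 0 m m'] that by (simp add: assms(6))
  have \<rho>x: "mono (\<lambda>x. \<rho> x m)" and \<rho>m: "mono (\<rho> x)" for x m
    by (auto intro!: monoI \<rho>)
  have \<rho>_meas: "(\<lambda>x. \<rho> x m) \<in> borel_measurable borel" for m
    by (rule borel_measurable_mono[OF \<rho>x])
  \<comment> \<open>Every interval is charged by the Gaussian law, so there is always room to the right of a
    given mean.\<close>
  have U: "0 < measure N {b..b + 1}" for b
  proof -
    have "measure N {b..b + 1} \<noteq> 0"
    proof
      assume "measure N {b..b + 1} = 0"
      then have "{b..b + 1} \<in> null_sets N"
        using finite_measure.emeasure_eq_measure[OF prob_space.finite_measure[OF Np]] by (auto simp: null_sets_def N)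
      then have "AE x in lborel. x \<notin> {b..b + 1}"
        using f0 by (simp add: N_def null_sets_density_iff ennreal_eq_0_iff flip: not_less)
      then have "{b..b + 1} \<in> null_sets lborel" by (simp add: AE_iff_null_sets)
      from null_setsD1[OF this] show False by simp
    qed
    then show ?thesis by (simp add: less_le)
  qed

  let ?S = "SUP m. SUP \<mu>\<in>equivalent_probs_mean N m. J m \<mu>"
  have V: "V = ?S"
  proof (rule antisym)
    show "V \<le> ?S"
      unfolding V_def centralized_welfare_def
    proof (rule SUP_least)
      fix Q assume Q: "Q \<in> equivalent_probs P"
      show "welfare T \<sigma> c R P Q \<le> ?S"
      proof (cases "relative_entropy Q P = \<infinity>")
        case False
        obtain m \<mu> where \<mu>: "\<mu> \<in> equivalent_probs_mean N m" and w: "welfare T \<sigma> c R P Q \<le> J m \<mu>"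
          using welfare_le_terminal_value[where R = R and \<rho> = \<rho> and \<sigma> = \<sigma>, OF P X N e assms(6) \<rho>_meas less_imp_le[OF assms(3)] Q False]
          unfolding J_def k_def by blast
        note w
        also have "J m \<mu> \<le> ?S"
          using \<mu> by (intro SUP_upper2[of m] SUP_upper) auto
        finally show ?thesis .
      qed (simp add: welfare_def)
    qed
    show "?S \<le> V"
      unfolding V_def J_def k_def
      by (intro SUP_least terminal_value_le_welfare[where R = R and \<rho> = \<rho>, OF P X N U assms(6) \<rho>x \<rho>m assms(3,2)])
  qed

  have gibbs: "gibbs_measure k f0 (\<lambda>x. \<rho> x m) l \<in> equivalent_probs_mean N m"
    and value_le: "\<And>\<mu>. \<mu> \<in> equivalent_probs_mean N m \<Longrightarrow>
      J m \<mu> \<le> ereal (l * m + k * ln (\<integral>y. gibbs_weight k f0 (\<lambda>x. \<rho> x m) l y \<partial>lborel))"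
    and value_eq: "J m (gibbs_measure k f0 (\<lambda>x. \<rho> x m) l) =
      ereal (l * m + k * ln (\<integral>y. gibbs_weight k f0 (\<lambda>x. \<rho> x m) l y \<partial>lborel))"
    if l: "mean_multiplier k f0 (\<lambda>x. \<rho> x m) m l" for m l
    using gibbs_measure_in_equivalent_probs_mean[OF f0 \<rho>_meas N_def[THEN meta_eq_to_obj_eq] Np l]
      gibbs_variational_principle[OF f0 \<rho>_meas k N_def[THEN meta_eq_to_obj_eq] Np l]
    by (simp_all add: J_def)

  show ?thesis
  proof (intro conjI allI impI ballI)
    show "V = ?S" by (rule V)
  next
    fix m l l'
    assume "mean_multiplier k f0 (\<lambda>x. \<rho> x m) m l" "mean_multiplier k f0 (\<lambda>x. \<rho> x m) m l'"
    then show "l' = l" by (rule mean_multiplier_unique[OF f0(2) k])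
  next
    fix m l \<mu>
    assume l: "mean_multiplier k f0 (\<lambda>x. \<rho> x m) m l"
    then show "gibbs_measure k f0 (\<lambda>x. \<rho> x m) l \<in> equivalent_probs_mean N m" by (rule gibbs)
    assume "\<mu> \<in> equivalent_probs_mean N m"
    then show "J m \<mu> \<le> J m (gibbs_measure k f0 (\<lambda>x. \<rho> x m) l)"
      unfolding value_eq[OF l] by (rule value_le[OF l])
  next
    fix m
    assume "{l. integrable lborel (gibbs_weight k f0 (\<lambda>x. \<rho> x m) l)} \<noteq> {} \<and>
      open {l. integrable lborel (gibbs_weight k f0 (\<lambda>x. \<rho> x m) l)}"
    then show "\<exists>l. mean_multiplier k f0 (\<lambda>x. \<rho> x m) m l"
      using mean_multiplier_exists[OF f0 \<rho>_meas k] by blast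
  next
    fix lam assume lam: "\<forall>m. mean_multiplier k f0 (\<lambda>x. \<rho> x m) m (lam m)"
    have "(SUP \<mu>\<in>equivalent_probs_mean N m. J m \<mu>) =
      ereal (lam m * m + k * ln (\<integral>y. gibbs_weight k f0 (\<lambda>x. \<rho> x m) (lam m) y \<partial>lborel))" for m
    proof (rule antisym)
      show "(SUP \<mu>\<in>equivalent_probs_mean N m. J m \<mu>) \<le>
        ereal (lam m * m + k * ln (\<integral>y. gibbs_weight k f0 (\<lambda>x. \<rho> x m) (lam m) y \<partial>lborel))"
        by (intro SUP_least value_le lam[rule_format])
      show "ereal (lam m * m + k * ln (\<integral>y. gibbs_weight k f0 (\<lambda>x. \<rho> x m) (lam m) y \<partial>lborel)) \<le>
        (SUP \<mu>\<in>equivalent_probs_mean N m. J m \<mu>)"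
        unfolding value_eq[OF lam[rule_format], symmetric]
        by (intro SUP_upper gibbs lam[rule_format])
    qed
    then show "V = (SUP m. ereal (lam m * m
        + k * ln (\<integral>y. gibbs_weight k f0 (\<lambda>x. \<rho> x m) (lam m) y \<partial>lborel)))"
      unfolding V by simp
  qed
qed

end
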